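(* Let $\zeta_3(s_1,\dots,s_7)$ and $\zeta_{\mathfrak{sl}(4)}(s_1,\dots,s_6)$ be as defined in the context. (1) Suppose $\mathbf{s}=(s_1,\dots,s_7)\in\mathbb{N}^7$ (resp. $\mathbf{s}\in\mathbb{N}_0^7$). If the series $\zeta_3(\mathbf{s})$ converges, then $\zeta_3(\mathbf{s})$ is a finite $\mathbb{Q}$-linear combination of MZVs of the same weight (resp. of the same or lower weights) and of depth three or less. (2) Let $w$ be a positive integer. Every convergent value $\zeta_{\mathfrak{sl}(4)}(s_1,\dots,s_6)$ with $s_1,\dots,s_6\in\mathbb{N}_0$ and $s_1+\dots+s_6=w$ (a Witten multiple zeta value of weight $w$ attached to $\mathfrak{sl}(4)$) is a finite $\mathbb{Q}$-linear combination of MZVs of weight $w$ and depth three or less. The only exceptions are the nine irregular families of values listed in the context. For these, in addition, the Riemann zeta value $\zeta(w-2)$ and double zeta values of weight $w-1$ and depth $\le 2$ may be needed. That is, an irregular value lies in the $\mathbb{Q}$-span of MZVs of weight $w$ and depth $\le 3$, MZVs of weight $w-1$ and depth $\le 2$, and $\zeta(w-2)$.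
   Context: $\mathbb{N}$ denotes the positive integers and $\mathbb{N}_0=\mathbb{N}\cup\{0\}$. For positive integers $s_1,\dots,s_d$ with $s_1\ge 2$, the multiple zeta value (MZV) is $$\zeta(s_1,\dots,s_d)=\sum_{m_1>m_2>\dots>m_d\ge 1} m_1^{-s_1}\cdots m_d^{-s_d}.$$ It has weight $s_1+\dots+s_d$ and depth $d$. The Riemann zeta value $\zeta(s)$ is the case $d=1$. For nonnegative integers $s_1,\dots,s_7$ define $$\zeta_3(s_1,\dots,s_7)=\sum_{m_1,m_2,m_3=1}^\infty \frac{1}{m_1^{s_1}m_2^{s_2}m_3^{s_3}(m_1+m_2)^{s_4}(m_2+m_3)^{s_5}(m_1+m_3)^{s_6}(m_1+m_2+m_3)^{s_7}},$$ whose weight is $s_1+\dots+s_7$. Define also $$\zeta_{\mathfrak{sl}(4)}(s_1,\dots,s_6)=\sum_{m_1,m_2,m_3=1}^\infty \frac{1}{m_1^{s_1}m_2^{s_2}m_3^{s_3}(m_1+m_2)^{s_4}(m_2+m_3)^{s_5}(m_1+m_2+m_3)^{s_6}},$$ so that $\zeta_{\mathfrak{sl}(4)}(s_1,\dots,s_6)=\zeta_3(s_1,\dots,s_5,0,s_6)$. Its weight is $s_1+\dots+s_6$. The nine irregular families are the following (write $\{0\}_k$ for $k$ zeros): - $\zeta_{\mathfrak{sl}(4)}(0,0,0,b,0,a)$ and $\zeta_{\mathfrak{sl}(4)}(0,0,0,0,b,a)$, for integers $a>1$, $b\ge 1$; - $\zeta_{\mathfrak{sl}(4)}(b,0,0,0,0,a)$,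 $\zeta_{\mathfrak{sl}(4)}(0,b,0,0,0,a)$ and $\zeta_{\mathfrak{sl}(4)}(0,0,b,0,0,a)$, for integers $a>2$, $b\ge 1$; - $\zeta_{\mathfrak{sl}(4)}(\{0\}_5,a)$, for integers $a>3$; - $\zeta_{\mathfrak{sl}(4)}(0,0,s_3,s_4,0,s_6)$ and $\zeta_{\mathfrak{sl}(4)}(s_1,0,0,0,s_5,s_6)$, for any nonnegative integers for which the series converges; - $\zeta_{\mathfrak{sl}(4)}(0,0,0,a,b,0)$, for integers $a,b\ge 2$. All other convergent values of $\zeta_{\mathfrak{sl}(4)}$ at nonnegative integers are called regular. *)

theory Defs
  imports "HOL-Analysis.Infinite_Sum"
begin

text \<open>
  All series below have nonnegative terms; convergence (in any order of summation) is
  unconditional summability over the index set, and the value is the unordered sum.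
\<close>

definition mzv :: "nat list \<Rightarrow> real" where
  "mzv s = (\<Sum>\<^sub>\<infinity>m\<in>{m :: nat list. length m = length s \<and> sorted_wrt (>) m \<and> (\<forall>x\<in>set m. 1 \<le> x)}.
              \<Prod>i<length s. 1 / real (m ! i) ^ (s ! i))"

text \<open>The depth is at least 1: the empty multiple zeta value 1 (weight 0) is not counted.\<close>

definition admissible :: "nat list \<Rightarrow> bool" where
  "admissible s \<longleftrightarrow> s \<noteq> [] \<and> (\<forall>x\<in>set s. 1 \<le> x) \<and> hd s \<ge> 2"

abbreviation weight :: "nat list \<Rightarrow> nat" where
  "weight s \<equiv> sum_list s"

abbreviation depth :: "nat list \<Rightarrow> nat" where
  "depth s \<equiv> length s"

definition MZVs :: "nat \<Rightarrow> nat \<Rightarrow> real set" where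
  "MZVs w d = {mzv s | s. admissible s \<and> weight s = w \<and> depth s \<le> d}"

definition rat_span :: "real set \<Rightarrow> real set" where
  "rat_span = module.span (\<lambda>(q::rat) (x::real). of_rat q * x)"

lemma vector_space_rat_real: "vector_space (\<lambda>(q::rat) (x::real). of_rat q * x)"
  by unfold_locales (simp_all add: algebra_simps of_rat_add of_rat_mult)

lemma rat_span_explicit:
  "rat_span B = {\<Sum>b\<in>T. of_rat (q b) * b | T q. finite T \<and> T \<subseteq> B}"
proof -
  interpret vector_space "\<lambda>(q::rat) (x::real). of_rat q * x"
    by (rule vector_space_rat_real)
  show ?thesis
    unfolding rat_span_def span_explicit ..
qed

definition pos_triples :: "(nat \<times> nat \<times> nat) set" where
  "pos_triples = {1..} \<times> {1..} \<times> {1..}"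

definition zeta3_term ::
  "nat \<Rightarrow> nat \<Rightarrow> nat \<Rightarrow> nat \<Rightarrow> nat \<Rightarrow> nat \<Rightarrow> nat \<Rightarrow> nat \<times> nat \<times> nat \<Rightarrow> real" where
  "zeta3_term s1 s2 s3 s4 s5 s6 s7 = (\<lambda>(m1, m2, m3).
     1 / (real m1 ^ s1 * real m2 ^ s2 * real m3 ^ s3 * real (m1 + m2) ^ s4 *
          real (m2 + m3) ^ s5 * real (m1 + m3) ^ s6 * real (m1 + m2 + m3) ^ s7))"

definition zeta3 :: "nat \<Rightarrow> nat \<Rightarrow> nat \<Rightarrow> nat \<Rightarrow> nat \<Rightarrow> nat \<Rightarrow> nat \<Rightarrow> real" where
  "zeta3 s1 s2 s3 s4 s5 s6 s7 = infsum (zeta3_term s1 s2 s3 s4 s5 s6 s7) pos_triples"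

definition zeta3_converges ::
  "nat \<Rightarrow> nat \<Rightarrow> nat \<Rightarrow> nat \<Rightarrow> nat \<Rightarrow> nat \<Rightarrow> nat \<Rightarrow> bool" where
  "zeta3_converges s1 s2 s3 s4 s5 s6 s7 \<longleftrightarrow>
     zeta3_term s1 s2 s3 s4 s5 s6 s7 summable_on pos_triples"

definition zeta_sl4_term ::
  "nat \<Rightarrow> nat \<Rightarrow> nat \<Rightarrow> nat \<Rightarrow> nat \<Rightarrow> nat \<Rightarrow> nat \<times> nat \<times> nat \<Rightarrow> real" where
  "zeta_sl4_term s1 s2 s3 s4 s5 s6 = (\<lambda>(m1, m2, m3).
     1 / (real m1 ^ s1 * real m2 ^ s2 * real m3 ^ s3 * real (m1 + m2) ^ s4 *
          real (m2 + m3) ^ s5 * real (m1 + m2 + m3) ^ s6))"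

definition zeta_sl4 :: "nat \<Rightarrow> nat \<Rightarrow> nat \<Rightarrow> nat \<Rightarrow> nat \<Rightarrow> nat \<Rightarrow> real" where
  "zeta_sl4 s1 s2 s3 s4 s5 s6 = infsum (zeta_sl4_term s1 s2 s3 s4 s5 s6) pos_triples"

definition zeta_sl4_converges ::
  "nat \<Rightarrow> nat \<Rightarrow> nat \<Rightarrow> nat \<Rightarrow> nat \<Rightarrow> nat \<Rightarrow> bool" where
  "zeta_sl4_converges s1 s2 s3 s4 s5 s6 \<longleftrightarrow>
     zeta_sl4_term s1 s2 s3 s4 s5 s6 summable_on pos_triples"

lemma zeta_sl4_term_eq_zeta3_term:
  "zeta_sl4_term s1 s2 s3 s4 s5 s6 = zeta3_term s1 s2 s3 s4 s5 0 s6"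
  by (simp add: zeta_sl4_term_def zeta3_term_def)

lemma zeta_sl4_eq_zeta3: "zeta_sl4 s1 s2 s3 s4 s5 s6 = zeta3 s1 s2 s3 s4 s5 0 s6"
  by (simp add: zeta_sl4_def zeta3_def zeta_sl4_term_eq_zeta3_term)

text \<open>
  The families may overlap, and some of the listed argument tuples (such as
  \<open>(0, 0, 0, 1, 0, 2)\<close>) give divergent series, so this predicate is only meaningful
  together with \<^const>\<open>zeta_sl4_converges\<close>.
\<close>

inductive irregular_sl4 :: "nat \<Rightarrow> nat \<Rightarrow> nat \<Rightarrow> nat \<Rightarrow> nat \<Rightarrow> nat \<Rightarrow> bool" where
  "a > 1 \<Longrightarrow> b \<ge> 1 \<Longrightarrow> irregular_sl4 0 0 0 b 0 a"
| "a > 1 \<Longrightarrow> b \<ge> 1 \<Longrightarrow> irregular_sl4 0 0 0 0 b a"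
| "a > 2 \<Longrightarrow> b \<ge> 1 \<Longrightarrow> irregular_sl4 b 0 0 0 0 a"
| "a > 2 \<Longrightarrow> b \<ge> 1 \<Longrightarrow> irregular_sl4 0 b 0 0 0 a"
| "a > 2 \<Longrightarrow> b \<ge> 1 \<Longrightarrow> irregular_sl4 0 0 b 0 0 a"
| "a > 3 \<Longrightarrow> irregular_sl4 0 0 0 0 0 a"
| "zeta_sl4_converges 0 0 s3 s4 0 s6 \<Longrightarrow> irregular_sl4 0 0 s3 s4 0 s6"
| "zeta_sl4_converges s1 0 0 0 s5 s6 \<Longrightarrow> irregular_sl4 s1 0 0 0 s5 s6"
| "a \<ge> 2 \<Longrightarrow> b \<ge> 2 \<Longrightarrow> irregular_sl4 0 0 0 a b 0"

end

theory Submission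
  imports Defs "HOL-Analysis.Harmonic_Numbers" "HOL-Analysis.Poly_Roots"
    "HOL-Computational_Algebra.Polynomial"
begin

text \<open>
  Truncate the triple series at \<open>n = m1 + m2 + m3 \<le> N\<close>. Partial fractions along the linear relations
  \<open>m1 + (m2 + m3) = n\<close>, \<open>m1 + m2 + m3 = n\<close>, \<open>(m1 + m2) + (m1 + m3) - m1 = n\<close>,
  \<open>(m1 + m2) + (m2 + m3) + (m1 + m3) = 2n\<close> and between \<open>m1\<close>, \<open>m2\<close>, \<open>m1 + m2\<close> reduce the truncated
  sum, with the weight preserved, to sums involving only \<open>n\<close> and two other forms. These are either truncated MZVs
  or, for the forms \<open>m1 + m2\<close> and \<open>m2 + m3\<close>, become so by inclusion-exclusion. The truncated MZVs that
  appear may diverge, but stuffle regularization writes each as a polynomial in the harmonic number \<open>H\<^sub>N\<close> whose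
  constant term is a combination of convergent ones of the same weight. Since \<open>H\<^sub>N \<rightarrow> \<infinity>\<close>, the limit of a
  convergent combination is its constant term. The irregular values are those for which fewer than
  three independent forms occur, or only \<open>m1 + m2\<close> and \<open>m2 + m3\<close>; there one summation only counts
  lattice points, which lowers the weight.
\<close>

section \<open>Truncated multiple zeta values\<close>

text \<open>Partial fractions split a convergent series into pieces that may diverge, so every
  identity is proved for finite sums at a fixed \<open>N\<close>, and a limit is taken only once, at
  the end. The leftover sums are nested sums with nonzero exponents only if
  \<open>m1 + m2 + m3\<close> occurs; a series without it must pass through a relation that creates
  it, and two of the sums \<open>m1 + m2\<close>, \<open>m2 + m3\<close>, \<open>m1 + m3\<close>
  alone offer no such relation. Since the limit is known to exist, rationality is tracked for
  constant terms only; the coefficients of positive powers of H_N may be arbitrary reals. These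
  coefficients vary with \<open>N\<close>, and what allows them to be replaced by their limits
  inside a polynomial in H_N is that partial sums of convergent MZVs approach their limits with an
  error smaller than every power of 1/H_N. Convergence enters through necessary conditions, obtained
  by letting one or two variables run over a block from \<open>M + 1\<close> to \<open>2 * M\<close>
  with the others equal to 1. They exclude the patterns that no relation can handle and match the
  degenerate ones with the listed families.\<close>

lemma filterlim_finite_subsets_at_top_incseq:
  assumes "\<And>N. finite (B N)" "incseq B" "(\<Union>N. B N) = A"
  shows "filterlim B (finite_subsets_at_top A) sequentially"
  unfolding filterlim_iff eventually_finite_subsets_at_top
proof (intro allI impI)
  fix P assume "\<exists>X. finite X \<and> X \<subseteq> A \<and> (\<forall>Y. finite Y \<and> X \<subseteq> Y \<and> Y \<subseteq> A \<longrightarrow> P Y)"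
  then obtain X where X: "finite X" "X \<subseteq> A" "\<forall>Y. finite Y \<and> X \<subseteq> Y \<and> Y \<subseteq> A \<longrightarrow> P Y"
    by (elim exE conjE)
  have "\<exists>N. X \<subseteq> B N"
    using X(1,2)
  proof induction
    case (insert x F)
    then obtain M N where "F \<subseteq> B M" "x \<in> B N"
      using assms(3) by blast
    then have "insert x F \<subseteq> B (max M N)"
      using incseqD[OF assms(2), of M "max M N"] incseqD[OF assms(2), of N "max M N"] by auto
    then show ?case ..
  qed simp
  then obtain N where N: "X \<subseteq> B N" ..
  have "P (B n)" if "n \<ge> N" for n
  proof (rule X(3)[rule_format], intro conjI)
    show "X \<subseteq> B n"
      using N incseqD[OF assms(2) that] by (rule subset_trans)
    show "B n \<subseteq> A"
      using assms(3) by blast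
  qed (rule assms(1))
  then show "\<forall>\<^sub>F n in sequentially. P (B n)"
    unfolding eventually_sequentially by blast
qed

lemma sum_tendsto_infsum_incseq:
  fixes f :: "'a \<Rightarrow> real"
  assumes "f summable_on A" "\<And>N. finite (B N)" "incseq B" "(\<Union>N. B N) = A"
  shows "(\<lambda>N. sum f (B N)) \<longlonglongrightarrow> infsum f A"
  by (rule filterlim_compose[OF has_sum_infsum[OF assms(1), unfolded has_sum_def]
        filterlim_finite_subsets_at_top_incseq[OF assms(2-4)]])

text \<open>For nonnegative terms a limit along one exhaustion bounds every finite partial sum,
  because each finite set is swallowed by some \<open>B N\<close>. Summability is therefore part of
  what is gained, and the unordered sum must agree with the limit.\<close>

lemma infsum_eqI_incseq:
  fixes f :: "'a \<Rightarrow> real"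
  assumes "\<And>x. x \<in> A \<Longrightarrow> f x \<ge> 0" "\<And>N. finite (B N)" "incseq B" "(\<Union>N. B N) = A"
    and lim: "(\<lambda>N. sum f (B N)) \<longlonglongrightarrow> L"
  shows "infsum f A = L"
proof -
  have sub: "B N \<subseteq> A" for N
    using assms(4) by blast
  have inc: "incseq (\<lambda>N. sum f (B N))"
    using assms(1,2) sub incseqD[OF assms(3)] by (intro incseq_SucI sum_mono2) auto
  have "sum f X \<le> L" if X: "finite X" "X \<subseteq> A" for X
  proof -
    have "\<forall>\<^sub>F Y in finite_subsets_at_top A. X \<subseteq> Y"
      using X by (auto simp: eventually_finite_subsets_at_top)
    then have "\<forall>\<^sub>F N in sequentially. X \<subseteq> B N"
      using filterlim_finite_subsets_at_top_incseq[OF assms(2-4)]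
      by (auto simp: filterlim_iff)
    then obtain N where "X \<subseteq> B N"
      by (auto simp: eventually_sequentially)
    then have "sum f X \<le> sum f (B N)"
      using assms(1,2) subsetD[OF sub] by (intro sum_mono2) auto
    then show ?thesis
      using incseq_le[OF inc lim, of N] by simp
  qed
  then have "f summable_on A"
    using assms(1) by (intro nonneg_bdd_above_summable_on) (auto intro!: bdd_aboveI)
  from sum_tendsto_infsum_incseq[OF this assms(2-4)] lim show ?thesis
    by (rule LIMSEQ_unique)
qed

text \<open>The truncated multiple harmonic sum over \<open>N\<close> \<ge> m_1 > ... > m_d \<ge> 1:
  the outer index is \<open>Suc n\<close>, so the inner bound \<open>n\<close> encodes strict
  descent. Exponent 0 is allowed and serves later to count lattice points.\<close>

fun mhs :: "nat list \<Rightarrow> nat \<Rightarrow> real" where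
  "mhs [] N = 1"
| "mhs (s # ss) N = (\<Sum>n<N. mhs ss n / real (Suc n) ^ s)"

definition dec_chains :: "nat \<Rightarrow> nat \<Rightarrow> nat list set" where
  "dec_chains d N = {m. length m = d \<and> sorted_wrt (>) m \<and> set m \<subseteq> {1..N}}"

lemma dec_chains_0: "dec_chains 0 N = {[]}"
  by (auto simp: dec_chains_def)

lemma dec_chains_Suc: "dec_chains (Suc d) N = (\<Union>n<N. (#) (Suc n) ` dec_chains d n)"
proof (intro set_eqI iffI)
  fix m assume "m \<in> dec_chains (Suc d) N"
  then obtain x l where m: "m = x # l" "length l = d" "\<And>y. y \<in> set l \<Longrightarrow> y < x"
      "sorted_wrt (>) l" "set l \<subseteq> {1..N}" "1 \<le> x" "x \<le> N"
    by (cases m) (auto simp: dec_chains_def)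
  have "y \<in> {1..x - 1}" if "y \<in> set l" for y
    using m(3)[OF that] subsetD[OF m(5) that] by simp
  with m have "l \<in> dec_chains d (x - 1)"
    by (auto simp: dec_chains_def)
  moreover have "m = Suc (x - 1) # l" "x - 1 < N"
    using m by auto
  ultimately show "m \<in> (\<Union>n<N. (#) (Suc n) ` dec_chains d n)"
    by blast
next
  fix m assume "m \<in> (\<Union>n<N. (#) (Suc n) ` dec_chains d n)"
  then obtain n l where m: "n < N" "m = Suc n # l" "length l = d" "sorted_wrt (>) l"
      and l: "set l \<subseteq> {1..n}"
    by (auto simp: dec_chains_def)
  have "x < Suc n \<and> 1 \<le> x \<and> x \<le> N" if "x \<in> set l" for x
    using subsetD[OF l that] m(1) by simp
  with m show "m \<in> dec_chains (Suc d) N"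
    by (auto simp: dec_chains_def)
qed

lemma finite_dec_chains [simp]: "finite (dec_chains d N)"
  by (induction d arbitrary: N) (auto simp: dec_chains_0 dec_chains_Suc)

lemma mhs_eq_sum:
  "mhs s N = (\<Sum>m\<in>dec_chains (length s) N. \<Prod>i<length s. 1 / real (m ! i) ^ (s ! i))"
proof (induction s arbitrary: N)
  case (Cons a s)
  have "(\<Sum>m\<in>dec_chains (length (a # s)) N. \<Prod>i<length (a # s). 1 / real (m ! i) ^ ((a # s) ! i))
      = (\<Sum>n<N. \<Sum>m\<in>(#) (Suc n) ` dec_chains (length s) n.
           \<Prod>i<length (a # s). 1 / real (m ! i) ^ ((a # s) ! i))"
    by (simp only: dec_chains_Suc length_Cons, rule sum.UNION_disjoint) auto
  also have "\<dots> = mhs (a # s) N"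
    by (simp add: sum.reindex prod.lessThan_Suc_shift Cons.IH sum_distrib_left sum_divide_distrib
        del: prod.lessThan_Suc of_nat_Suc)
  finally show ?case ..
qed (simp add: dec_chains_0)

lemma mzv_eqI:
  assumes "mhs s \<longlonglongrightarrow> L"
  shows "mzv s = L"
  unfolding mzv_def
proof (rule infsum_eqI_incseq)
  let ?B = "dec_chains (length s)"
  show "incseq ?B"
    unfolding incseq_def dec_chains_def by (intro allI impI Collect_mono) (auto dest: subsetD)
  show "(\<Union>N. ?B N) = {m. length m = length s \<and> sorted_wrt (>) m \<and> (\<forall>x\<in>set m. 1 \<le> x)}"
  proof (intro equalityI subsetI)
    fix m :: "nat list" assume m: "m \<in> {m. length m = length s \<and> sorted_wrt (>) m \<and> (\<forall>x\<in>set m. 1 \<le> x)}"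
    have "x \<le> sum_list m" if "x \<in> set m" for x
      using that by (simp add: member_le_sum_list)
    with m have "m \<in> ?B (sum_list m)"
      by (auto simp: dec_chains_def)
    then show "m \<in> (\<Union>N. ?B N)"
      by blast
  qed (auto simp: dec_chains_def)
  show "(\<lambda>N. \<Sum>m\<in>?B N. \<Prod>i<length s. 1 / real (m ! i) ^ (s ! i)) \<longlonglongrightarrow> L"
    using assms unfolding mhs_eq_sum [abs_def] .
qed (auto intro: prod_nonneg)

abbreviation hsum :: "nat \<Rightarrow> real" where
  "hsum \<equiv> mhs [Suc 0]"

lemma mhs_nonneg: "mhs s N \<ge> 0"
  by (induction s arbitrary: N) (auto intro!: sum_nonneg)

lemma mhs_mono: "M \<le> N \<Longrightarrow> mhs s M \<le> mhs s N"
  by (cases s) (auto intro!: sum_mono2 simp: mhs_nonneg)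

text \<open>Replacing every exponent by 1 and forgetting the order of the indices leaves a product
  of independent harmonic sums.\<close>

lemma mhs_le_hsum_power:
  assumes "\<forall>x\<in>set s. 1 \<le> x"
  shows "mhs s N \<le> hsum N ^ length s"
  using assms
proof (induction s arbitrary: N)
  case (Cons a s)
  have "mhs s n / real (Suc n) ^ a \<le> hsum N ^ length s * (1 / real (Suc n))" if "n < N" for n
  proof -
    have "mhs s n \<le> hsum n ^ length s"
      using Cons by simp
    also have "\<dots> \<le> hsum N ^ length s"
      using that by (intro power_mono mhs_mono mhs_nonneg) auto
    finally have 1: "mhs s n \<le> hsum N ^ length s" .
    have 2: "1 / real (Suc n) ^ a \<le> 1 / real (Suc n)"
      using power_increasing[of 1 a "real (Suc n)"] Cons.prems
      by (intro divide_left_mono) (auto simp del: of_nat_Suc)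
    show ?thesis
      using mult_mono[OF 1 2] by (simp add: mhs_nonneg del: mhs.simps of_nat_Suc)
  qed
  then have "mhs (a # s) N \<le> (\<Sum>n<N. hsum N ^ length s * (1 / real (Suc n)))"
    unfolding mhs.simps(2) by (intro sum_mono) (auto simp del: mhs.simps)
  also have "\<dots> = hsum N ^ length (a # s)"
    by (simp only: sum_distrib_left [symmetric]) simp
  finally show ?case .
qed simp

lemma hsum_eq_harm: "hsum N = harm N"
  by (simp add: harm_altdef divide_inverse)

lemma hsum_at_top: "filterlim hsum at_top sequentially"
  using harm_at_top by (simp add: hsum_eq_harm [abs_def] del: mhs.simps)

lemma summable_hsum_power: "summable (\<lambda>n. hsum (Suc n) ^ k / real (Suc n) ^ 2)"
proof (rule summable_comparison_test')
  \<comment> \<open>H_n is bounded by a constant times n^a. This \<open>a\<close> keeps n^(a k)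
    below n^(1/2), leaving the summable n^(-3/2); \<open>Suc k\<close> keeps the denominator nonzero
    for \<open>k = 0\<close>.\<close>
  define a where "a = 1 / (2 * real (Suc k))"
  have a: "a > 0" "a * real k \<le> 1 / 2"
    by (simp_all add: a_def field_simps)
  show "summable (\<lambda>n. (1 + 1 / a) ^ k * real (Suc n) powr (-3/2))"
    using summable_real_powr_iff[of "-3/2"]
    by (intro summable_mult) (subst summable_Suc_iff [of "\<lambda>n. real n powr (-3/2)"], simp)
  show "norm (hsum (Suc n) ^ k / real (Suc n) ^ 2) \<le> (1 + 1 / a) ^ k * real (Suc n) powr (-3/2)"
    if "n \<ge> 0" for n
  proof -
    have "hsum (Suc n) \<le> 1 + ln (real (Suc n))"
      using decseqD[OF decseq_harm_diff_ln, of 0 n]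
      by (simp add: hsum_eq_harm harm_expand del: mhs.simps)
    also have "\<dots> \<le> real (Suc n) powr a + real (Suc n) powr a / a"
      using a by (intro add_mono ln_powr_bound ge_one_powr_ge_zero) auto
    finally have "hsum (Suc n) ^ k \<le> ((1 + 1 / a) * real (Suc n) powr a) ^ k"
      by (intro power_mono mhs_nonneg) (simp add: algebra_simps)
    also have "\<dots> = (1 + 1 / a) ^ k * real (Suc n) powr (a * real k)"
      by (simp add: power_mult_distrib powr_realpow [symmetric] powr_powr)
    also have "\<dots> \<le> (1 + 1 / a) ^ k * real (Suc n) powr (1 / 2)"
      using a by (intro mult_left_mono powr_mono) auto
    finally have "hsum (Suc n) ^ k / real (Suc n) ^ 2
        \<le> (1 + 1 / a) ^ k * real (Suc n) powr (1 / 2) / real (Suc n) ^ 2"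
      by (rule divide_right_mono) simp
    also have "\<dots> = (1 + 1 / a) ^ k * (real (Suc n) powr (1 / 2) / real (Suc n) powr 2)"
      by (simp add: powr_numeral)
    also have "real (Suc n) powr (1 / 2) / real (Suc n) powr 2 = real (Suc n) powr (-3/2)"
      by (subst powr_diff [symmetric]) simp
    finally show ?thesis
      by (simp add: mhs_nonneg del: mhs.simps)
  qed
qed

section \<open>Stuffle regularization\<close>

text \<open>A rational span of functions of \<open>N\<close>, so membership records an identity
  valid at every truncation. The inductive form gives induction over linear combinations
  directly.\<close>

inductive_set mhs_span :: "nat list set \<Rightarrow> (nat \<Rightarrow> real) set" for W where
  zero: "(\<lambda>_. 0) \<in> mhs_span W"
| word: "s \<in> W \<Longrightarrow> mhs s \<in> mhs_span W"
| add: "f \<in> mhs_span W \<Longrightarrow> g \<in> mhs_span W \<Longrightarrow> (\<lambda>N. f N + g N) \<in> mhs_span W"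
| scale: "f \<in> mhs_span W \<Longrightarrow> (\<lambda>N. of_rat q * f N) \<in> mhs_span W"

lemma mhs_span_mono:
  "f \<in> mhs_span W \<Longrightarrow> W \<subseteq> W' \<Longrightarrow> f \<in> mhs_span W'"
  by (induction rule: mhs_span.induct) (auto intro: mhs_span.intros)

lemma mhs_span_minus: "f \<in> mhs_span W \<Longrightarrow> (\<lambda>N. - f N) \<in> mhs_span W"
  using mhs_span.scale[of f W "-1"] by (simp add: of_rat_minus)

lemma mhs_span_diff:
  "f \<in> mhs_span W \<Longrightarrow> g \<in> mhs_span W \<Longrightarrow> (\<lambda>N. f N - g N) \<in> mhs_span W"
  using mhs_span.add[OF _ mhs_span_minus, of f W g] by simp

text \<open>Stuffle regularization writes a truncated sum as a polynomial in \<^const>\<open>harm\<close>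
  whose coefficients converge faster than any power of \<^const>\<open>harm\<close> grows.\<close>

definition rapid :: "(nat \<Rightarrow> real) \<Rightarrow> bool" where
  "rapid A \<longleftrightarrow> (\<exists>a. \<forall>k. (\<lambda>N. (A N - a) * hsum N ^ k) \<longlonglongrightarrow> 0)"

lemma rapid_const: "rapid (\<lambda>_. c)"
  unfolding rapid_def by (rule exI[of _ c]) simp

lemma rapid_add:
  assumes "rapid A" "rapid B"
  shows "rapid (\<lambda>N. A N + B N)"
proof -
  obtain a b where "\<forall>k. (\<lambda>N. (A N - a) * hsum N ^ k) \<longlonglongrightarrow> 0" "\<forall>k. (\<lambda>N. (B N - b) * hsum N ^ k) \<longlonglongrightarrow> 0"
    using assms by (auto simp only: rapid_def)
  then have "(\<lambda>N. (A N + B N - (a + b)) * hsum N ^ k) \<longlonglongrightarrow> 0" for k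
    using tendsto_add[of "\<lambda>N. (A N - a) * hsum N ^ k" 0 sequentially "\<lambda>N. (B N - b) * hsum N ^ k" 0]
    by (simp add: algebra_simps del: mhs.simps)
  then show ?thesis
    unfolding rapid_def by blast
qed

lemma rapid_scale:
  assumes "rapid A"
  shows "rapid (\<lambda>N. c * A N)"
proof -
  obtain a where "\<forall>k. (\<lambda>N. (A N - a) * hsum N ^ k) \<longlonglongrightarrow> 0"
    using assms by (auto simp only: rapid_def)
  then have "(\<lambda>N. (c * A N - c * a) * hsum N ^ k) \<longlonglongrightarrow> 0" for k
    using tendsto_mult_left[of "\<lambda>N. (A N - a) * hsum N ^ k" 0 sequentially c]
    by (simp add: algebra_simps del: mhs.simps)
  then show ?thesis
    unfolding rapid_def by blast
qed

lemma rapid_tendsto: "rapid A \<Longrightarrow> \<exists>a. A \<longlonglongrightarrow> a"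
  unfolding rapid_def by (metis (no_types, lifting) LIM_zero_iff ext mult.right_neutral power_0)

text \<open>A first entry 1 is allowed: these index truncated sums whose series may diverge, in
  contrast to \<open>adm_words\<close>.\<close>

definition words :: "nat \<Rightarrow> nat \<Rightarrow> nat list set" where
  "words w d = {s. s \<noteq> [] \<and> (\<forall>x\<in>set s. 1 \<le> x) \<and> sum_list s = w \<and> length s \<le> d}"

definition adm_words :: "nat \<Rightarrow> nat \<Rightarrow> nat list set" where
  "adm_words w d = {s. admissible s \<and> sum_list s = w \<and> length s \<le> d}"

lemma MZVs_eq: "MZVs w d = mzv ` adm_words w d"
  by (auto simp: MZVs_def adm_words_def)

text \<open>The error at \<open>N\<close> is a tail of \<Sum> f n. As H is increasing, multiplying
  that tail by H_N^k gives at most the tail of \<Sum> f n H_(n+1)^k, which converges because f n is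
  at most a power of H_(n+1) over (n+1)^2.\<close>

lemma rapid_mhs:
  assumes "admissible s"
  shows "rapid (mhs s)"
proof -
  obtain a t where s: "s = a # t" "a \<ge> 2" "\<forall>x\<in>set t. 1 \<le> x"
    using assms by (cases s) (auto simp: admissible_def)
  define f where "f n = mhs t n / real (Suc n) ^ a" for n
  have f_le: "f n * hsum (Suc n) ^ k \<le> hsum (Suc n) ^ (length t + k) / real (Suc n) ^ 2" for n k
  proof -
    have "mhs t n \<le> hsum (Suc n) ^ length t"
      using mhs_le_hsum_power[OF s(3), of n] power_mono[OF mhs_mono[of n "Suc n" "[Suc 0]"] mhs_nonneg]
      by (rule order_trans) simp
    moreover have "1 / real (Suc n) ^ a \<le> 1 / real (Suc n) ^ 2"
      using s(2) by (intro divide_left_mono power_increasing) auto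
    ultimately have "mhs t n * (1 / real (Suc n) ^ a) \<le> hsum (Suc n) ^ length t * (1 / real (Suc n) ^ 2)"
      by (intro mult_mono) (auto simp: mhs_nonneg simp del: mhs.simps)
    then have "f n * hsum (Suc n) ^ k \<le> hsum (Suc n) ^ length t * (1 / real (Suc n) ^ 2) * hsum (Suc n) ^ k"
      unfolding f_def by (intro mult_right_mono) (auto simp: mhs_nonneg simp del: mhs.simps)
    also have "\<dots> = hsum (Suc n) ^ (length t + k) / real (Suc n) ^ 2"
      by (simp add: power_add del: mhs.simps)
    finally show ?thesis .
  qed
  have f_nonneg: "0 \<le> f n" for n
    by (simp add: f_def mhs_nonneg)
  have summ: "summable (\<lambda>n. f n * hsum (Suc n) ^ k)" for k
    using f_le f_nonneg
    by (intro summable_comparison_test'[OF summable_hsum_power[of "length t + k"], of 0])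
      (auto simp: mhs_nonneg abs_mult simp del: mhs.simps)
  have "(\<lambda>N. (mhs s N - (\<Sum>n. f n)) * hsum N ^ k) \<longlonglongrightarrow> 0" for k
  proof (rule Lim_null_comparison)
    have sf: "summable f"
      using summ[of 0] by simp
    have "norm ((mhs s N - (\<Sum>n. f n)) * hsum N ^ k) \<le> (\<Sum>n. f (n + N) * hsum (Suc (n + N)) ^ k)" for N
    proof -
      have "(\<Sum>n. f n) - mhs s N = (\<Sum>n. f (n + N))"
        using suminf_minus_initial_segment[OF sf, of N] by (simp add: s f_def)
      moreover have "(\<Sum>n. f (n + N)) \<ge> 0"
        using sf f_nonneg by (intro suminf_nonneg) (auto simp: summable_iff_shift)
      ultimately have "norm ((mhs s N - (\<Sum>n. f n)) * hsum N ^ k) = (\<Sum>n. f (n + N)) * hsum N ^ k"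
        by (simp add: abs_mult mhs_nonneg abs_minus_commute[of "mhs s N"] del: mhs.simps)
      also have "\<dots> = (\<Sum>n. f (n + N) * hsum N ^ k)"
        using sf by (intro suminf_mult2) (auto simp: summable_iff_shift)
      also have "\<dots> \<le> (\<Sum>n. f (n + N) * hsum (Suc (n + N)) ^ k)"
      proof (rule suminf_le)
        show "f (n + N) * hsum N ^ k \<le> f (n + N) * hsum (Suc (n + N)) ^ k" for n
          by (intro mult_left_mono power_mono mhs_mono mhs_nonneg f_nonneg) simp
        show "summable (\<lambda>n. f (n + N) * hsum N ^ k)"
          using sf by (intro summable_mult2) (auto simp: summable_iff_shift)
        show "summable (\<lambda>n. f (n + N) * hsum (Suc (n + N)) ^ k)"
          using summ[of k] summable_iff_shift[of "\<lambda>n. f n * hsum (Suc n) ^ k" N] by simp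
      qed
      finally show ?thesis .
    qed
    then show "\<forall>\<^sub>F N in sequentially. norm ((mhs s N - (\<Sum>n. f n)) * hsum N ^ k)
        \<le> (\<Sum>n. f (n + N) * hsum (Suc (n + N)) ^ k)"
      by (intro always_eventually allI)
    show "(\<lambda>N. \<Sum>n. f (n + N) * hsum (Suc (n + N)) ^ k) \<longlonglongrightarrow> 0"
      using tendsto_diff[OF tendsto_const summable_LIMSEQ[OF summ[of k]], of "\<Sum>n. f n * hsum (Suc n) ^ k"]
      by (simp add: suminf_minus_initial_segment[OF summ[of k]] del: mhs.simps)
  qed
  then show ?thesis
    unfolding rapid_def by blast
qed

lemma rapid_mhs_span:
  "f \<in> mhs_span W \<Longrightarrow> W \<subseteq> Collect admissible \<Longrightarrow> rapid f"
  by (induction rule: mhs_span.induct)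
    (auto intro: rapid_const rapid_mhs rapid_add rapid_scale)

text \<open>Polynomials in H_N in Horner form, with coefficients that depend on \<open>N\<close> and
  converge rapidly.\<close>

inductive_set hpoly :: "(nat \<Rightarrow> real) set" where
  const: "rapid A \<Longrightarrow> A \<in> hpoly"
| step: "rapid A \<Longrightarrow> B \<in> hpoly \<Longrightarrow> (\<lambda>N. A N + hsum N * B N) \<in> hpoly"

lemma hpoly_add:
  "f \<in> hpoly \<Longrightarrow> g \<in> hpoly \<Longrightarrow> (\<lambda>N. f N + g N) \<in> hpoly"
proof (induction arbitrary: g rule: hpoly.induct)
  case (const A)
  from const(2,1) show ?case
  proof (cases rule: hpoly.cases)
    case (step A' B)
    have "(\<lambda>N. (A N + A' N) + hsum N * B N) \<in> hpoly"
      using const step by (intro hpoly.step rapid_add)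
    then show ?thesis
      by (simp add: step(1) add.assoc del: mhs.simps)
  qed (auto intro: hpoly.const rapid_add)
next
  case (step A B)
  from step(4) show ?case
  proof (cases rule: hpoly.cases)
    case const
    have "(\<lambda>N. (A N + g N) + hsum N * B N) \<in> hpoly"
      using const step by (intro hpoly.step rapid_add)
    then show ?thesis
      by (simp add: algebra_simps del: mhs.simps)
  next
    case (step A' B')
    have "(\<lambda>N. (A N + A' N) + hsum N * (B N + B' N)) \<in> hpoly"
      using step \<open>rapid A\<close> step.IH[OF \<open>B' \<in> hpoly\<close>] by (intro hpoly.step rapid_add) auto
    then show ?thesis
      by (simp add: \<open>g = _\<close> algebra_simps del: mhs.simps)
  qed
qed

lemma hpoly_scale: "f \<in> hpoly \<Longrightarrow> (\<lambda>N. c * f N) \<in> hpoly"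
proof (induction rule: hpoly.induct)
  case (step A B)
  have "(\<lambda>N. (c * A N) + hsum N * (c * B N)) \<in> hpoly"
    using step by (intro hpoly.step rapid_scale)
  then show ?case
    by (simp add: algebra_simps del: mhs.simps)
qed (auto intro: hpoly.const rapid_scale)

text \<open>Coefficients are replaced by their limits. The arbitrary factor H_N^k makes the
  induction close, since a Horner step multiplies the error by one more H_N.\<close>

lemma hpoly_asymp:
  assumes "f \<in> hpoly"
  shows "\<exists>p. \<forall>k. (\<lambda>N. (f N - poly p (hsum N)) * hsum N ^ k) \<longlonglongrightarrow> 0"
  using assms
proof (induction rule: hpoly.induct)
  case (const A)
  then obtain a where "\<forall>k. (\<lambda>N. (A N - a) * hsum N ^ k) \<longlonglongrightarrow> 0"
    by (auto simp only: rapid_def)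
  then show ?case
    by (intro exI[of _ "[:a:]"]) (simp del: mhs.simps)
next
  case (step A B)
  then obtain p a where *: "\<forall>k. (\<lambda>N. (A N - a) * hsum N ^ k) \<longlonglongrightarrow> 0"
      "\<forall>k. (\<lambda>N. (B N - poly p (hsum N)) * hsum N ^ k) \<longlonglongrightarrow> 0"
    by (auto simp only: rapid_def)
  have "(\<lambda>N. (A N + hsum N * B N - poly (pCons a p) (hsum N)) * hsum N ^ k) \<longlonglongrightarrow> 0" for k
    using tendsto_add[OF *(1)[rule_format, of k] *(2)[rule_format, of "Suc k"]]
    by (simp add: algebra_simps del: mhs.simps)
  then show ?case
    by blast
qed

text \<open>H_N tends to infinity, along which a nonconstant polynomial is unbounded.\<close>

lemma poly_hsum_convergent:
  assumes "(\<lambda>N. poly p (hsum N)) \<longlonglongrightarrow> L"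
  shows "L = coeff p 0"
proof -
  have "degree p = 0"
  proof (rule ccontr)
    assume "degree p \<noteq> 0"
    then have "\<exists>k. k \<noteq> 0 \<and> k \<le> degree p \<and> coeff p k \<noteq> 0"
      by (intro exI[of _ "degree p"]) auto
    from polyfun_extremal[OF this, of "\<bar>L\<bar> + 1"]
    have "\<forall>\<^sub>F x in at_infinity. \<bar>L\<bar> + 1 \<le> \<bar>poly p x\<bar>"
      by (simp add: poly_altdef)
    moreover have "filterlim hsum at_infinity sequentially"
      using hsum_at_top by (rule filterlim_at_top_imp_at_infinity)
    ultimately have "\<forall>\<^sub>F N in sequentially. \<bar>L\<bar> + 1 \<le> \<bar>poly p (hsum N)\<bar>"
      by (rule eventually_compose_filterlim)
    then have "\<bar>L\<bar> + 1 \<le> \<bar>L\<bar>"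
      using tendsto_rabs[OF assms] by (intro tendsto_lowerbound) auto
    then show False
      by simp
  qed
  then obtain c where "p = [:c:]"
    by (rule degree_eq_zeroE)
  with assms show ?thesis
    by (simp add: LIMSEQ_const_iff)
qed

text \<open>\<open>A\<close> is the constant term of a polynomial in H_N and the only part whose
  words are recorded.\<close>

definition regularizable :: "nat list set \<Rightarrow> (nat \<Rightarrow> real) set" where
  "regularizable X = {\<lambda>N. A N + hsum N * B N | A B. A \<in> mhs_span X \<and> B \<in> hpoly}"

lemma regularizableI:
  "A \<in> mhs_span X \<Longrightarrow> B \<in> hpoly \<Longrightarrow> (\<lambda>N. A N + hsum N * B N) \<in> regularizable X"
  unfolding regularizable_def by blast

lemma regularizable_add:
  assumes "f \<in> regularizable X" "g \<in> regularizable X"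
  shows "(\<lambda>N. f N + g N) \<in> regularizable X"
proof -
  obtain A B A' B' where *: "f = (\<lambda>N. A N + hsum N * B N)" "A \<in> mhs_span X" "B \<in> hpoly"
      "g = (\<lambda>N. A' N + hsum N * B' N)" "A' \<in> mhs_span X" "B' \<in> hpoly"
    using assms unfolding regularizable_def by blast
  have "(\<lambda>N. (A N + A' N) + hsum N * (B N + B' N)) \<in> regularizable X"
    using * by (intro regularizableI mhs_span.add hpoly_add)
  then show ?thesis
    by (simp add: * algebra_simps del: mhs.simps)
qed

lemma regularizable_scale:
  assumes "f \<in> regularizable X"
  shows "(\<lambda>N. of_rat q * f N) \<in> regularizable X"
proof -
  obtain A B where *: "f = (\<lambda>N. A N + hsum N * B N)" "A \<in> mhs_span X" "B \<in> hpoly"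
    using assms unfolding regularizable_def by blast
  have "(\<lambda>N. of_rat q * A N + hsum N * (of_rat q * B N)) \<in> regularizable X"
    using * by (intro regularizableI mhs_span.scale hpoly_scale)
  then show ?thesis
    by (simp add: * algebra_simps del: mhs.simps)
qed

lemma regularizable_diff:
  "f \<in> regularizable X \<Longrightarrow> g \<in> regularizable X \<Longrightarrow> (\<lambda>N. f N - g N) \<in> regularizable X"
  using regularizable_add[OF _ regularizable_scale[of g X "-1"], of f] by (simp add: of_rat_minus)

lemma mhs_span_regularizable: "f \<in> mhs_span X \<Longrightarrow> f \<in> regularizable X"
  using regularizableI[of f X "\<lambda>_. 0"] by (simp add: hpoly.const rapid_const)

text \<open>A factor H_N moves the former constant term to degree one, so the new constant term is
  zero and lies in the span of any \<open>Y\<close>.\<close>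

lemma regularizable_hsum_times:
  assumes "f \<in> regularizable X" "X \<subseteq> Collect admissible"
  shows "(\<lambda>N. hsum N * f N) \<in> regularizable Y"
proof -
  obtain A B where *: "f = (\<lambda>N. A N + hsum N * B N)" "A \<in> mhs_span X" "B \<in> hpoly"
    using assms unfolding regularizable_def by blast
  then have "f \<in> hpoly"
    using assms rapid_mhs_span by (auto intro: hpoly.step simp del: mhs.simps)
  then show ?thesis
    using regularizableI[OF mhs_span.zero[of Y]] by simp
qed

lemma tendsto_mhs_span:
  assumes "f \<in> mhs_span X" "X \<subseteq> Collect admissible"
  shows "\<exists>L. f \<longlonglongrightarrow> L \<and> L \<in> rat_span (mzv ` X)"
proof -
  interpret Q: vector_space "\<lambda>(q::rat) (x::real). of_rat q * x"
    by (rule vector_space_rat_real)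
  show ?thesis
    using assms unfolding rat_span_def
  proof (induction rule: mhs_span.induct)
    case zero
    then show ?case
      by (intro exI[of _ 0]) (simp add: Q.span_zero)
  next
    case (word s)
    then obtain L where "mhs s \<longlonglongrightarrow> L"
      using rapid_tendsto[OF rapid_mhs] by blast
    with word show ?case
      by (intro exI[of _ L]) (auto intro!: Q.span_base image_eqI[of _ mzv s] simp: mzv_eqI)
  next
    case (add f g)
    then show ?case
      by (blast intro: tendsto_add Q.span_add)
  next
    case (scale f q)
    then show ?case
      by (blast intro: tendsto_mult_left Q.span_scale)
  qed
qed

lemma regularizable_limit:
  assumes "f \<in> regularizable X" "X \<subseteq> Collect admissible" "f \<longlonglongrightarrow> L"
  shows "L \<in> rat_span (mzv ` X)"
proof -
  obtain A B where *: "f = (\<lambda>N. A N + hsum N * B N)" "A \<in> mhs_span X" "B \<in> hpoly"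
    using assms unfolding regularizable_def by blast
  obtain a where a: "A \<longlonglongrightarrow> a" "a \<in> rat_span (mzv ` X)"
    using tendsto_mhs_span[OF *(2) assms(2)] by blast
  \<comment> \<open>The power 1 is the factor H_N that stands in front of \<open>B\<close>.\<close>
  obtain p where p: "(\<lambda>N. (B N - poly p (hsum N)) * hsum N ^ 1) \<longlonglongrightarrow> 0"
    using hpoly_asymp[OF *(3)] by blast
  have "(\<lambda>N. poly (pCons 0 p) (hsum N)) \<longlonglongrightarrow> L - a"
    using tendsto_diff[OF tendsto_diff[OF assms(3) a(1)] p]
    by (simp add: *(1) algebra_simps del: mhs.simps)
  from poly_hsum_convergent[OF this] a show ?thesis
    by simp
qed

text \<open>The three sums collect the pairs of outermost indices in which the first is larger, the
  second is larger, or both agree.\<close>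

lemma stuffle:
  "mhs (a # u) N * mhs (b # v) N =
     (\<Sum>n<N. mhs u n * mhs (b # v) n / real (Suc n) ^ a) +
     (\<Sum>n<N. mhs (a # u) n * mhs v n / real (Suc n) ^ b) +
     (\<Sum>n<N. mhs u n * mhs v n / real (Suc n) ^ (a + b))"
  by (induction N) (simp_all add: algebra_simps power_add del: of_nat_Suc)

lemma stuffle_1_1:
  "mhs [a] N * mhs [b] N = mhs [a, b] N + mhs [b, a] N + mhs [a + b] N"
  by (subst stuffle) (simp add: del: of_nat_Suc)

lemma stuffle_1_2:
  "mhs [a] N * mhs [b, c] N =
     mhs [a, b, c] N + mhs [b, a, c] N + mhs [b, c, a] N + mhs [a + b, c] N + mhs [b, a + c] N"
proof -
  have "(\<Sum>n<N. mhs [a] n * mhs [c] n / real (Suc n) ^ b)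
      = mhs [b, a, c] N + mhs [b, c, a] N + mhs [b, a + c] N"
    by (subst stuffle_1_1) (simp add: sum.distrib add_divide_distrib del: of_nat_Suc)
  then show ?thesis
    by (subst stuffle) (simp del: of_nat_Suc)
qed

lemma mhs_regularizable_admissible:
  "admissible s \<Longrightarrow> sum_list s = w \<Longrightarrow> length s \<le> d \<Longrightarrow> mhs s \<in> regularizable (adm_words w d)"
  by (intro mhs_span_regularizable mhs_span.word) (simp add: adm_words_def)

lemma hsum_regularizable: "hsum \<in> regularizable X"
  using regularizableI[OF mhs_span.zero hpoly.const[OF rapid_const[of 1]]]
  by (simp del: mhs.simps)

lemma adm_words_admissible: "adm_words w d \<subseteq> Collect admissible"
  by (auto simp: adm_words_def)

lemma mhs_regularizable_1:
  assumes "a \<ge> 1" "d \<ge> 1"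
  shows "mhs [a] \<in> regularizable (adm_words a d)"
  using assms by (cases "a = 1") (auto intro: hsum_regularizable mhs_regularizable_admissible
      simp: admissible_def simp del: mhs.simps)

text \<open>A leading 1 is removed by solving the stuffle product of H_N with \<open>mhs [b]\<close>
  for \<open>mhs [1, b]\<close>. For \<open>b = 1\<close> that word occurs twice, whence the factor
  1/2.\<close>

lemma mhs_regularizable_2:
  assumes "a \<ge> 1" "b \<ge> 1" "d \<ge> 2"
  shows "mhs [a, b] \<in> regularizable (adm_words (a + b) d)"
proof (cases "a \<ge> 2")
  case True
  with assms show ?thesis
    by (intro mhs_regularizable_admissible) (auto simp: admissible_def)
next
  case False
  with assms have a: "a = Suc 0"
    by simp
  show ?thesis
  proof (cases "b \<ge> 2")
    case True
    have "(\<lambda>N. hsum N * mhs [b] N - mhs [b, Suc 0] N - mhs [Suc b] N)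
        \<in> regularizable (adm_words (Suc b) d)"
      using True assms
      by (intro regularizable_diff regularizable_hsum_times[OF _ adm_words_admissible[of b 1]]
          mhs_regularizable_admissible) (auto simp: admissible_def)
    then show ?thesis
      by (simp add: a stuffle_1_1 del: mhs.simps)
  next
    case False
    with assms have b: "b = Suc 0"
      by simp
    have "(\<lambda>N. of_rat (1 / 2) * (hsum N * hsum N - mhs [2] N))
        \<in> regularizable (adm_words 2 d)"
      using assms
      by (intro regularizable_scale regularizable_diff
          regularizable_hsum_times[OF hsum_regularizable, of "{}"] mhs_regularizable_admissible)
        (auto simp: admissible_def)
    then show ?thesis
      by (simp add: a b stuffle_1_1 of_rat_divide numeral_2_eq_2 del: mhs.simps)
  qed
qed

text \<open>The stuffle product of H_N with \<open>mhs [b, c]\<close> is solved for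
  \<open>mhs [1, b, c]\<close>. That word occurs once if \<open>b\<close> \<ge> 2, twice if only
  \<open>b = 1\<close>, and three times if \<open>b = c = 1\<close>, whence the factors 1/2 and 1/3.
  In the second case the product also contains \<open>mhs [1, c, 1]\<close>, which the first case
  (\<open>R3'\<close>) covers.\<close>

lemma mhs_regularizable_3:
  assumes "a \<ge> 1" "b \<ge> 1" "c \<ge> 1" "d \<ge> 3"
  shows "mhs [a, b, c] \<in> regularizable (adm_words (a + b + c) d)"
proof (cases "a \<ge> 2")
  case True
  with assms show ?thesis
    by (intro mhs_regularizable_admissible) (auto simp: admissible_def)
next
  case False
  with assms have a: "a = Suc 0"
    by simp
  have hsum_times: "(\<lambda>N. hsum N * mhs [b, c] N) \<in> regularizable (adm_words (Suc (b + c)) d)"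
    using assms
    by (intro regularizable_hsum_times[OF mhs_regularizable_2[of b c 2] adm_words_admissible]) auto
  have R2: "mhs [p, q] \<in> regularizable (adm_words (Suc (b + c)) d)"
    if "p \<ge> 1" "q \<ge> 1" "p + q = Suc (b + c)" for p q
    using mhs_regularizable_2[of p q d] that assms by simp
  have R3: "mhs [p, q, r] \<in> regularizable (adm_words (Suc (b + c)) d)"
    if "p \<ge> 2" "q \<ge> 1" "r \<ge> 1" "p + q + r = Suc (b + c)" for p q r
    using that assms by (intro mhs_regularizable_admissible) (auto simp: admissible_def)
  have R3': "mhs [Suc 0, p, q] \<in> regularizable (adm_words (Suc (b + c)) d)"
    if "p \<ge> 2" "q \<ge> 1" "p + q = b + c" for p q
  proof -
    have "(\<lambda>N. hsum N * mhs [p, q] N - mhs [p, Suc 0, q] N - mhs [p, q, Suc 0] N - mhs [Suc p, q] N - mhs [p, Suc q] N)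
        \<in> regularizable (adm_words (Suc (b + c)) d)"
      using that assms
      by (intro regularizable_diff R2 R3
          regularizable_hsum_times[OF mhs_regularizable_2[of p q 2] adm_words_admissible]) auto
    then show ?thesis
      by (simp add: stuffle_1_2 del: mhs.simps)
  qed
  show ?thesis
  proof (cases "b \<ge> 2")
    case True
    with R3'[of b c] assms show ?thesis
      by (simp add: a)
  next
    case False
    with assms have b: "b = Suc 0"
      by simp
    show ?thesis
    proof (cases "c \<ge> 2")
      case True
      have "(\<lambda>N. of_rat (1 / 2) * (hsum N * mhs [b, c] N - mhs [Suc 0, c, Suc 0] N - mhs [2, c] N - mhs [b, Suc c] N))
          \<in> regularizable (adm_words (Suc (b + c)) d)"
        using True assms b by (intro regularizable_scale regularizable_diff R2 R3' hsum_times) auto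
      then show ?thesis
        by (simp add: a b stuffle_1_2 of_rat_divide numeral_2_eq_2 del: mhs.simps)
    next
      case False
      with assms have c: "c = Suc 0"
        by simp
      have "(\<lambda>N. of_rat (1 / 3) * (hsum N * mhs [b, c] N - mhs [2, c] N - mhs [b, 2] N))
          \<in> regularizable (adm_words (Suc (b + c)) d)"
        using assms b c by (intro regularizable_scale regularizable_diff R2 hsum_times) auto
      then show ?thesis
        by (simp add: a b c stuffle_1_2 of_rat_divide numeral_2_eq_2 del: mhs.simps)
    qed
  qed
qed

lemma mhs_regularizable_words:
  assumes "s \<in> words w d" "d \<le> 3"
  shows "mhs s \<in> regularizable (adm_words w d)"
proof -
  consider a where "s = [a]" | a b where "s = [a, b]" | a b c where "s = [a, b, c]"
    using assms by (auto simp: words_def le_Suc_eq numeral_3_eq_3 length_Suc_conv)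
  then show ?thesis
    using assms mhs_regularizable_1 mhs_regularizable_2 mhs_regularizable_3
    by cases (fastforce simp: words_def add.assoc simp del: mhs.simps)+
qed

lemma regularizable_mono:
  "f \<in> regularizable X \<Longrightarrow> X \<subseteq> Y \<Longrightarrow> f \<in> regularizable Y"
  unfolding regularizable_def using mhs_span_mono by blast

text \<open>Regularization keeps the weight of each word separately, so several weights can be
  treated together; the union over \<open>I\<close> is what the irregular values require.\<close>

lemma mhs_span_words_limit:
  assumes "f \<in> mhs_span (\<Union>(w, d)\<in>I. words w d)" "\<And>w d. (w, d) \<in> I \<Longrightarrow> d \<le> 3" "f \<longlonglongrightarrow> L"
  shows "L \<in> rat_span (\<Union>(w, d)\<in>I. MZVs w d)"
proof -
  let ?X = "\<Union>(w, d)\<in>I. adm_words w d"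
  have "f \<in> regularizable ?X"
    using assms(1)
  proof (induction rule: mhs_span.induct)
    case zero
    show ?case
      by (rule mhs_span_regularizable[OF mhs_span.zero])
  next
    case (word s)
    then obtain w d where wd: "(w, d) \<in> I" "s \<in> words w d"
      by blast
    show ?case
      by (rule regularizable_mono[OF mhs_regularizable_words[OF wd(2) assms(2)[OF wd(1)]]])
        (use wd in blast)
  qed (auto intro: regularizable_add regularizable_scale)
  moreover have "?X \<subseteq> Collect admissible"
    by (auto simp: adm_words_def)
  ultimately have "L \<in> rat_span (mzv ` ?X)"
    using assms(3) by (rule regularizable_limit)
  also have "mzv ` ?X = (\<Union>(w, d)\<in>I. MZVs w d)"
    by (auto simp: MZVs_eq image_UN)
  finally show ?thesis .
qed

section \<open>Partial fractions\<close>

definition pairs :: "nat \<Rightarrow> (nat \<times> nat) set" where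
  "pairs N = {(m, y). 1 \<le> m \<and> 1 \<le> y \<and> m + y \<le> N}"

text \<open>The truncated Tornheim double sum.\<close>

definition pair_sum :: "nat \<Rightarrow> nat \<Rightarrow> nat \<Rightarrow> nat \<Rightarrow> real" where
  "pair_sum a b e N = (\<Sum>(m, y)\<in>pairs N. 1 / (real m ^ a * real y ^ b * real (m + y) ^ e))"

lemma pair_sum_swap: "pair_sum a b e = pair_sum b a e"
  unfolding pair_sum_def
  by (intro ext sum.reindex_bij_witness[of _ prod.swap prod.swap]) (auto simp: pairs_def ac_simps)

lemma partial_fraction:
  fixes x y :: real
  assumes "x \<noteq> 0" "y \<noteq> 0" "x + y \<noteq> 0"
  shows "1 / (x ^ Suc a * y ^ Suc b * (x + y) ^ e) =
    1 / (x ^ a * y ^ Suc b * (x + y) ^ Suc e) + 1 / (x ^ Suc a * y ^ b * (x + y) ^ Suc e)"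
proof -
  let ?T = "1 / (x ^ Suc a * y ^ Suc b * (x + y) ^ Suc e)"
  have "1 / (x ^ Suc a * y ^ Suc b * (x + y) ^ e) = (x + y) * ?T"
    "1 / (x ^ a * y ^ Suc b * (x + y) ^ Suc e) = x * ?T"
    "1 / (x ^ Suc a * y ^ b * (x + y) ^ Suc e) = y * ?T"
    using assms by simp_all
  then show ?thesis
    by (simp only: distrib_right)
qed

lemma pair_sum_step:
  "pair_sum (Suc a) (Suc b) e N = pair_sum a (Suc b) (Suc e) N + pair_sum (Suc a) b (Suc e) N"
  unfolding pair_sum_def sum.distrib [symmetric]
  by (rule sum.cong) (auto simp: pairs_def partial_fraction simp del: power_Suc)

lemma pair_sum_eq_mhs: "pair_sum a 0 e = mhs [e, a]"
proof
  fix N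
  have "mhs [e, a] N = (\<Sum>(n, k)\<in>Sigma {..<N} lessThan. 1 / real (Suc k) ^ a / real (Suc n) ^ e)"
    by (simp add: sum.Sigma [symmetric] sum_divide_distrib del: of_nat_Suc)
  also have "\<dots> = pair_sum a 0 e N"
    unfolding pair_sum_def
    by (rule sum.reindex_bij_witness[of _ "\<lambda>(m, y). (m + y - 1, m - 1)" "\<lambda>(n, k). (Suc k, n - k)"])
      (auto simp: pairs_def of_nat_diff simp del: of_nat_Suc, simp add: add.commute)
  finally show "pair_sum a 0 e N = mhs [e, a] N" ..
qed

lemma mhs_span_word:
  "s \<noteq> [] \<Longrightarrow> \<forall>x\<in>set s. 1 \<le> x \<Longrightarrow> sum_list s = w \<Longrightarrow> length s \<le> d \<Longrightarrow> mhs s \<in> mhs_span (words w d)"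
  by (intro mhs_span.word) (simp add: words_def)

text \<open>Each partial fraction lowers \<open>a\<close> or \<open>b\<close> and raises
  \<open>e\<close>, until one of the two is 0 and a nested double sum remains. The assumption
  ensures that its two exponents are positive.\<close>

lemma pair_sum_in_span:
  assumes "a \<ge> 1 \<and> b \<ge> 1 \<or> e \<ge> 1 \<and> (a \<ge> 1 \<or> b \<ge> 1)"
  shows "pair_sum a b e \<in> mhs_span (words (a + b + e) 2)"
  using assms
proof (induction "a + b" arbitrary: a b e rule: less_induct)
  case less
  show ?case
  proof (cases a; cases b)
    fix a' b' assume ab: "a = Suc a'" "b = Suc b'"
    have "(\<lambda>N. pair_sum a' b (Suc e) N + pair_sum a b' (Suc e) N)
        \<in> mhs_span (words (a + b + e) 2)"
      using less.hyps[of a' b "Suc e"] less.hyps[of a b' "Suc e"] ab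
      by (intro mhs_span.add) simp_all
    also have "(\<lambda>N. pair_sum a' b (Suc e) N + pair_sum a b' (Suc e) N) = pair_sum a b e"
      by (simp add: ab pair_sum_step fun_eq_iff)
    finally show ?thesis .
  next
    fix b' assume "a = 0" "b = Suc b'"
    with less.prems show ?thesis
      by (subst pair_sum_swap) (auto simp: pair_sum_eq_mhs intro!: mhs_span_word)
  qed (use less.prems in \<open>auto simp: pair_sum_eq_mhs intro!: mhs_span_word\<close>)
qed

text \<open>There are n pairs of positive integers with sum n + 1, and n = (n + 1) - 1 cancels one
  power in the denominator. This is the basic mechanism of weight drop.\<close>

lemma pair_sum_0_0:
  assumes "e \<ge> 2"
  shows "pair_sum 0 0 e = (\<lambda>N. mhs [e - 1] N - mhs [e] N)"
proof -
  obtain k where e: "e = Suc k"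
    using assms by (cases e) auto
  have "real n / real (Suc n) ^ Suc k = (real (Suc n) - 1) / real (Suc n) ^ Suc k" for n
    by simp
  moreover have "(real (Suc n) - 1) / real (Suc n) ^ Suc k = 1 / real (Suc n) ^ k - 1 / real (Suc n) ^ Suc k" for n
    by (subst diff_divide_distrib) (simp del: of_nat_Suc)
  ultimately have "real n / real (Suc n) ^ Suc k = 1 / real (Suc n) ^ k - 1 / real (Suc n) ^ Suc k" for n
    by simp
  then show ?thesis
    by (simp add: fun_eq_iff pair_sum_eq_mhs e sum_subtractf del: of_nat_Suc power_Suc)
qed

section \<open>Truncated triple sums and the linear relations between their forms\<close>

definition triples :: "nat \<Rightarrow> (nat \<times> nat \<times> nat) set" where
  "triples N = {(m1, m2, m3). 1 \<le> m1 \<and> 1 \<le> m2 \<and> 1 \<le> m3 \<and> m1 + m2 + m3 \<le> N}"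

lemma finite_triples: "finite (triples N)"
  by (rule finite_subset[of _ "{..N} \<times> {..N} \<times> {..N}"]) (auto simp: triples_def)

definition zeta3_trunc ::
  "nat \<Rightarrow> nat \<Rightarrow> nat \<Rightarrow> nat \<Rightarrow> nat \<Rightarrow> nat \<Rightarrow> nat \<Rightarrow> nat \<Rightarrow> real" where
  "zeta3_trunc s1 s2 s3 s4 s5 s6 s7 N = sum (zeta3_term s1 s2 s3 s4 s5 s6 s7) (triples N)"

text \<open>Exchanging \<open>m1\<close> and \<open>m2\<close> fixes \<open>m1 + m2\<close> and
  exchanges \<open>m2 + m3\<close> with \<open>m1 + m3\<close>. Together with the exchange of
  \<open>m2\<close> and \<open>m3\<close> this generates all permutations of the variables.\<close>

lemma zeta3_trunc_swap12:
  "zeta3_trunc s1 s2 s3 s4 s5 s6 s7 = zeta3_trunc s2 s1 s3 s4 s6 s5 s7"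
  unfolding zeta3_trunc_def
  by (intro ext sum.reindex_bij_witness[of _ "\<lambda>(a, b, c). (b, a, c)" "\<lambda>(a, b, c). (b, a, c)"])
    (auto simp: triples_def zeta3_term_def ac_simps)

lemma zeta3_trunc_swap23:
  "zeta3_trunc s1 s2 s3 s4 s5 s6 s7 = zeta3_trunc s1 s3 s2 s6 s5 s4 s7"
  unfolding zeta3_trunc_def
  by (intro ext sum.reindex_bij_witness[of _ "\<lambda>(a, b, c). (a, c, b)" "\<lambda>(a, b, c). (a, c, b)"])
    (auto simp: triples_def zeta3_term_def ac_simps)

text \<open>A common denominator for the relations below: all terms of a relation are multiples of
  one term with every exponent involved raised, and the multipliers are exactly the linear forms
  that satisfy the relation.\<close>

lemma zeta3_term_lower:
  assumes "(m1, m2, m3) \<in> triples N"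
  shows "zeta3_term s1 s2 s3 s4 s5 s6 s7 (m1, m2, m3)
        = real m1 * zeta3_term (Suc s1) s2 s3 s4 s5 s6 s7 (m1, m2, m3)"
    and "zeta3_term s1 s2 s3 s4 s5 s6 s7 (m1, m2, m3)
        = real m2 * zeta3_term s1 (Suc s2) s3 s4 s5 s6 s7 (m1, m2, m3)"
    and "zeta3_term s1 s2 s3 s4 s5 s6 s7 (m1, m2, m3)
        = real m3 * zeta3_term s1 s2 (Suc s3) s4 s5 s6 s7 (m1, m2, m3)"
    and "zeta3_term s1 s2 s3 s4 s5 s6 s7 (m1, m2, m3)
        = real (m1 + m2) * zeta3_term s1 s2 s3 (Suc s4) s5 s6 s7 (m1, m2, m3)"
    and "zeta3_term s1 s2 s3 s4 s5 s6 s7 (m1, m2, m3)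
        = real (m2 + m3) * zeta3_term s1 s2 s3 s4 (Suc s5) s6 s7 (m1, m2, m3)"
    and "zeta3_term s1 s2 s3 s4 s5 s6 s7 (m1, m2, m3)
        = real (m1 + m3) * zeta3_term s1 s2 s3 s4 s5 (Suc s6) s7 (m1, m2, m3)"
    and "zeta3_term s1 s2 s3 s4 s5 s6 s7 (m1, m2, m3)
        = real (m1 + m2 + m3) * zeta3_term s1 s2 s3 s4 s5 s6 (Suc s7) (m1, m2, m3)"
  using assms by (simp_all add: zeta3_term_def triples_def del: of_nat_add)

lemma zeta3_trunc_m1_m2:
  "zeta3_trunc (Suc s1) (Suc s2) s3 s4 s5 s6 s7 N =
     zeta3_trunc s1 (Suc s2) s3 (Suc s4) s5 s6 s7 N + zeta3_trunc (Suc s1) s2 s3 (Suc s4) s5 s6 s7 N"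
proof -
  have "zeta3_term (Suc s1) (Suc s2) s3 s4 s5 s6 s7 t =
      zeta3_term s1 (Suc s2) s3 (Suc s4) s5 s6 s7 t + zeta3_term (Suc s1) s2 s3 (Suc s4) s5 s6 s7 t"
    if "t \<in> triples N" for t
  proof -
    obtain m1 m2 m3 where t: "t = (m1, m2, m3)"
      by (rule prod_cases3)
    show ?thesis
      using zeta3_term_lower(4)[OF that[unfolded t], of "Suc s1" "Suc s2" s3 s4 s5 s6 s7]
        zeta3_term_lower(1)[OF that[unfolded t], of s1 "Suc s2" s3 "Suc s4" s5 s6 s7]
        zeta3_term_lower(2)[OF that[unfolded t], of "Suc s1" s2 s3 "Suc s4" s5 s6 s7]
      by (simp add: t distrib_right)
  qed
  then show ?thesis
    by (simp add: zeta3_trunc_def sum.distrib [symmetric] cong: sum.cong)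
qed

lemma zeta3_trunc_m1_x23:
  "zeta3_trunc (Suc s1) s2 s3 s4 (Suc s5) s6 s7 N =
     zeta3_trunc s1 s2 s3 s4 (Suc s5) s6 (Suc s7) N + zeta3_trunc (Suc s1) s2 s3 s4 s5 s6 (Suc s7) N"
proof -
  have "zeta3_term (Suc s1) s2 s3 s4 (Suc s5) s6 s7 t =
      zeta3_term s1 s2 s3 s4 (Suc s5) s6 (Suc s7) t + zeta3_term (Suc s1) s2 s3 s4 s5 s6 (Suc s7) t"
    if "t \<in> triples N" for t
  proof -
    obtain m1 m2 m3 where t: "t = (m1, m2, m3)"
      by (rule prod_cases3)
    show ?thesis
      using zeta3_term_lower(7)[OF that[unfolded t], of "Suc s1" s2 s3 s4 "Suc s5" s6 s7]
        zeta3_term_lower(1)[OF that[unfolded t], of s1 s2 s3 s4 "Suc s5" s6 "Suc s7"]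
        zeta3_term_lower(5)[OF that[unfolded t], of "Suc s1" s2 s3 s4 s5 s6 "Suc s7"]
      by (simp add: t distrib_right)
  qed
  then show ?thesis
    by (simp add: zeta3_trunc_def sum.distrib [symmetric] cong: sum.cong)
qed

lemma zeta3_trunc_m1_m2_m3:
  "zeta3_trunc (Suc s1) (Suc s2) (Suc s3) s4 s5 s6 s7 N =
     zeta3_trunc s1 (Suc s2) (Suc s3) s4 s5 s6 (Suc s7) N +
     zeta3_trunc (Suc s1) s2 (Suc s3) s4 s5 s6 (Suc s7) N +
     zeta3_trunc (Suc s1) (Suc s2) s3 s4 s5 s6 (Suc s7) N"
proof -
  have "zeta3_term (Suc s1) (Suc s2) (Suc s3) s4 s5 s6 s7 t =
     zeta3_term s1 (Suc s2) (Suc s3) s4 s5 s6 (Suc s7) t +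
     zeta3_term (Suc s1) s2 (Suc s3) s4 s5 s6 (Suc s7) t +
     zeta3_term (Suc s1) (Suc s2) s3 s4 s5 s6 (Suc s7) t"
    if "t \<in> triples N" for t
  proof -
    obtain m1 m2 m3 where t: "t = (m1, m2, m3)"
      by (rule prod_cases3)
    show ?thesis
      using zeta3_term_lower(7)[OF that[unfolded t], of "Suc s1" "Suc s2" "Suc s3" s4 s5 s6 s7]
        zeta3_term_lower(1)[OF that[unfolded t], of s1 "Suc s2" "Suc s3" s4 s5 s6 "Suc s7"]
        zeta3_term_lower(2)[OF that[unfolded t], of "Suc s1" s2 "Suc s3" s4 s5 s6 "Suc s7"]
        zeta3_term_lower(3)[OF that[unfolded t], of "Suc s1" "Suc s2" s3 s4 s5 s6 "Suc s7"]
      by (simp add: t distrib_right)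
  qed
  then show ?thesis
    by (simp add: zeta3_trunc_def sum.distrib [symmetric] cong: sum.cong)
qed

lemma zeta3_trunc_m1_x12_x13:
  "zeta3_trunc (Suc s1) s2 s3 (Suc s4) s5 (Suc s6) s7 N =
     zeta3_trunc (Suc s1) s2 s3 s4 s5 (Suc s6) (Suc s7) N +
     zeta3_trunc (Suc s1) s2 s3 (Suc s4) s5 s6 (Suc s7) N -
     zeta3_trunc s1 s2 s3 (Suc s4) s5 (Suc s6) (Suc s7) N"
proof -
  have "zeta3_term (Suc s1) s2 s3 (Suc s4) s5 (Suc s6) s7 t =
     zeta3_term (Suc s1) s2 s3 s4 s5 (Suc s6) (Suc s7) t +
     zeta3_term (Suc s1) s2 s3 (Suc s4) s5 s6 (Suc s7) t -
     zeta3_term s1 s2 s3 (Suc s4) s5 (Suc s6) (Suc s7) t"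
    if "t \<in> triples N" for t
  proof -
    obtain m1 m2 m3 where t: "t = (m1, m2, m3)"
      by (rule prod_cases3)
    show ?thesis
      using zeta3_term_lower(7)[OF that[unfolded t], of "Suc s1" s2 s3 "Suc s4" s5 "Suc s6" s7]
        zeta3_term_lower(4)[OF that[unfolded t], of "Suc s1" s2 s3 s4 s5 "Suc s6" "Suc s7"]
        zeta3_term_lower(6)[OF that[unfolded t], of "Suc s1" s2 s3 "Suc s4" s5 s6 "Suc s7"]
        zeta3_term_lower(1)[OF that[unfolded t], of s1 s2 s3 "Suc s4" s5 "Suc s6" "Suc s7"]
      by (simp add: t distrib_right)
  qed
  then show ?thesis
    by (simp add: zeta3_trunc_def sum.distrib [symmetric] sum_subtractf [symmetric] cong: sum.cong)
qed

lemma zeta3_trunc_x12_x23_x13: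
  "2 * zeta3_trunc s1 s2 s3 (Suc s4) (Suc s5) (Suc s6) s7 N =
     zeta3_trunc s1 s2 s3 s4 (Suc s5) (Suc s6) (Suc s7) N +
     zeta3_trunc s1 s2 s3 (Suc s4) s5 (Suc s6) (Suc s7) N +
     zeta3_trunc s1 s2 s3 (Suc s4) (Suc s5) s6 (Suc s7) N"
proof -
  have "2 * zeta3_term s1 s2 s3 (Suc s4) (Suc s5) (Suc s6) s7 t =
     zeta3_term s1 s2 s3 s4 (Suc s5) (Suc s6) (Suc s7) t +
     zeta3_term s1 s2 s3 (Suc s4) s5 (Suc s6) (Suc s7) t +
     zeta3_term s1 s2 s3 (Suc s4) (Suc s5) s6 (Suc s7) t"
    if "t \<in> triples N" for t
  proof -
    obtain m1 m2 m3 where t: "t = (m1, m2, m3)"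
      by (rule prod_cases3)
    show ?thesis
      using zeta3_term_lower(7)[OF that[unfolded t], of s1 s2 s3 "Suc s4" "Suc s5" "Suc s6" s7]
        zeta3_term_lower(4)[OF that[unfolded t], of s1 s2 s3 s4 "Suc s5" "Suc s6" "Suc s7"]
        zeta3_term_lower(5)[OF that[unfolded t], of s1 s2 s3 "Suc s4" s5 "Suc s6" "Suc s7"]
        zeta3_term_lower(6)[OF that[unfolded t], of s1 s2 s3 "Suc s4" "Suc s5" s6 "Suc s7"]
      by (simp add: t distrib_right)
  qed
  then show ?thesis
    by (simp add: zeta3_trunc_def sum.distrib [symmetric] sum_distrib_left cong: sum.cong)
qed

text \<open>The partial sums \<open>m1\<close> < \<open>m1 + m2\<close> <
  \<open>m1 + m2 + m3\<close> run through all strictly increasing triples of positive integers up to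
  \<open>N\<close>.\<close>

lemma zeta3_trunc_chain: "zeta3_trunc a 0 0 b 0 0 e = mhs [e, b, a]"
proof
  fix N
  have "mhs [e, b, a] N = (\<Sum>(n, k, j)\<in>Sigma {..<N} (\<lambda>n. Sigma {..<n} lessThan).
      1 / real (Suc j) ^ a / real (Suc k) ^ b / real (Suc n) ^ e)"
    by (simp add: sum.Sigma [symmetric] sum_divide_distrib del: of_nat_Suc)
  also have "\<dots> = zeta3_trunc a 0 0 b 0 0 e N"
    unfolding zeta3_trunc_def
    by (rule sum.reindex_bij_witness[of _ "\<lambda>(m1, m2, m3). (m1 + m2 + m3 - 1, m1 + m2 - 1, m1 - 1)"
          "\<lambda>(n, k, j). (Suc j, k - j, n - k)"])
      (auto simp: triples_def zeta3_term_def of_nat_diff)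
  finally show "zeta3_trunc a 0 0 b 0 0 e N = mhs [e, b, a] N" ..
qed

lemma zeta3_trunc_m1_m2_x12_in_span:
  assumes "e \<ge> 1" "a \<ge> 1 \<and> b \<ge> 1 \<or> p \<ge> 1 \<and> (a \<ge> 1 \<or> b \<ge> 1)"
  shows "zeta3_trunc a b 0 p 0 0 e \<in> mhs_span (words (a + b + p + e) 3)"
  using assms(2)
proof (induction "a + b" arbitrary: a b p rule: less_induct)
  case less
  show ?case
  proof (cases a; cases b)
    fix a' b' assume ab: "a = Suc a'" "b = Suc b'"
    have "(\<lambda>N. zeta3_trunc a' b 0 (Suc p) 0 0 e N + zeta3_trunc a b' 0 (Suc p) 0 0 e N)
        \<in> mhs_span (words (a + b + p + e) 3)"
      using less.hyps[of a' b "Suc p"] less.hyps[of a b' "Suc p"] ab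
      by (intro mhs_span.add) simp_all
    also have "(\<lambda>N. zeta3_trunc a' b 0 (Suc p) 0 0 e N + zeta3_trunc a b' 0 (Suc p) 0 0 e N)
        = zeta3_trunc a b 0 p 0 0 e"
      by (simp add: ab zeta3_trunc_m1_m2 fun_eq_iff)
    finally show ?thesis .
  next
    fix b' assume "a = 0" "b = Suc b'"
    with less.prems \<open>e \<ge> 1\<close> show ?thesis
      by (subst zeta3_trunc_swap12) (auto simp: zeta3_trunc_chain intro!: mhs_span_word)
  qed (use less.prems \<open>e \<ge> 1\<close> in \<open>auto simp: zeta3_trunc_chain intro!: mhs_span_word\<close>)
qed

text \<open>Inclusion-exclusion over pairs \<open>x, y < n\<close>: with \<open>x = m1 + m2\<close>, \<open>y = m2 + m3\<close> and
  \<open>n = m1 + m2 + m3\<close>, the positivity of \<open>m2\<close> means \<open>x + y > n\<close>.\<close>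

lemma zeta3_trunc_x12_x23_eq:
  "zeta3_trunc 0 0 0 p q 0 e N =
     mhs [e, p, q] N + mhs [e, q, p] N + mhs [e, p + q] N
     - pair_sum p q e N - zeta3_trunc p q 0 0 0 0 e N"
proof -
  define f where "f = (\<lambda>(n, x, y). 1 / real x ^ p / real y ^ q / real n ^ e)"
  define T where "T = {(n, x, y). n \<le> N \<and> 1 \<le> x \<and> x < n \<and> 1 \<le> y \<and> y < n}"
  have fin: "finite T"
    by (rule finite_subset[of _ "{..N} \<times> {..N} \<times> {..N}"]) (auto simp: T_def)
  have "(\<Sum>n<N. mhs [p] n * mhs [q] n / real (Suc n) ^ e)
      = (\<Sum>(n, k, j)\<in>Sigma {..<N} (\<lambda>n. {..<n} \<times> {..<n}). f (Suc n, Suc k, Suc j))"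
    by (simp add: sum.Sigma [symmetric] sum.cartesian_product [symmetric] f_def sum_product
        sum_divide_distrib del: of_nat_Suc)
  also have "\<dots> = sum f T"
    by (rule sum.reindex_bij_witness[of _ "\<lambda>(n, x, y). (n - 1, x - 1, y - 1)"
          "\<lambda>(n, k, j). (Suc n, Suc k, Suc j)"]) (auto simp: T_def)
  also have "T = {(n, x, y) \<in> T. x + y < n} \<union> {(n, x, y) \<in> T. x + y = n} \<union> {(n, x, y) \<in> T. x + y > n}"
    by auto
  also have "sum f \<dots> = sum f {(n, x, y) \<in> T. x + y < n} + sum f {(n, x, y) \<in> T. x + y = n}
      + sum f {(n, x, y) \<in> T. x + y > n}"
    by (subst sum.union_disjoint, (auto intro: finite_subset[OF _ fin])[3],
        subst sum.union_disjoint, auto intro: finite_subset[OF _ fin])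
  also have "sum f {(n, x, y) \<in> T. x + y < n} = zeta3_trunc p q 0 0 0 0 e N"
    unfolding zeta3_trunc_def
    by (rule sum.reindex_bij_witness[of _ "\<lambda>(m1, m2, m3). (m1 + m2 + m3, m1, m2)"
          "\<lambda>(n, x, y). (x, y, n - x - y)"])
      (auto simp: T_def f_def triples_def zeta3_term_def of_nat_diff)
  also have "sum f {(n, x, y) \<in> T. x + y = n} = pair_sum p q e N"
    unfolding pair_sum_def
    by (rule sum.reindex_bij_witness[of _ "\<lambda>(x, y). (x + y, x, y)" "\<lambda>(n, x, y). (x, y)"])
      (auto simp: T_def f_def pairs_def)
  \<comment> \<open>The inverse map solves \<open>m1 + m2 = x\<close>, \<open>m2 + m3 = y\<close>,
    \<open>m1 + m2 + m3 = n\<close>.\<close>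
  also have "sum f {(n, x, y) \<in> T. x + y > n} = zeta3_trunc 0 0 0 p q 0 e N"
    unfolding zeta3_trunc_def
    by (rule sum.reindex_bij_witness[of _ "\<lambda>(m1, m2, m3). (m1 + m2 + m3, m1 + m2, m2 + m3)"
          "\<lambda>(n, x, y). (n - y, x + y - n, n - x)"])
      (auto simp: T_def f_def triples_def zeta3_term_def of_nat_diff)
  finally have "zeta3_trunc 0 0 0 p q 0 e N = (\<Sum>n<N. mhs [p] n * mhs [q] n / real (Suc n) ^ e)
      - pair_sum p q e N - zeta3_trunc p q 0 0 0 0 e N"
    by simp
  also have "(\<Sum>n<N. mhs [p] n * mhs [q] n / real (Suc n) ^ e)
      = mhs [e, p, q] N + mhs [e, q, p] N + mhs [e, p + q] N"
    unfolding mhs.simps(2)[of e] stuffle_1_1 add_divide_distrib sum.distrib ..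
  finally show ?thesis .
qed

lemma zeta3_trunc_x12_x23_in_span:
  assumes "p \<ge> 1" "q \<ge> 1" "e \<ge> 1"
  shows "zeta3_trunc 0 0 0 p q 0 e \<in> mhs_span (words (p + q + e) 3)"
proof -
  have "pair_sum p q e \<in> mhs_span (words (p + q + e) 3)"
    using assms by (intro mhs_span_mono[OF pair_sum_in_span]) (auto simp: words_def)
  moreover have "zeta3_trunc p q 0 0 0 0 e \<in> mhs_span (words (p + q + e) 3)"
    using zeta3_trunc_m1_m2_x12_in_span[of e p q 0] assms by simp
  ultimately show ?thesis
    unfolding zeta3_trunc_x12_x23_eq [abs_def] using assms
    by (intro mhs_span_diff mhs_span.add mhs_span_word) auto
qed

section \<open>Reduction of the exponents to two forms besides m1 + m2 + m3\<close>

definition reducible ::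
  "nat \<Rightarrow> nat \<Rightarrow> nat \<Rightarrow> nat \<Rightarrow> nat \<Rightarrow> nat \<Rightarrow> nat \<Rightarrow> bool" where
  "reducible s1 s2 s3 s4 s5 s6 s7 \<longleftrightarrow>
     zeta3_trunc s1 s2 s3 s4 s5 s6 s7 \<in> mhs_span (words (s1 + s2 + s3 + s4 + s5 + s6 + s7) 3)"

lemma reducible_swap12:
  "reducible s1 s2 s3 s4 s5 s6 s7 \<longleftrightarrow> reducible s2 s1 s3 s4 s6 s5 s7"
  unfolding reducible_def zeta3_trunc_swap12[of s1 s2 s3 s4 s5 s6 s7] by (simp add: ac_simps)

lemma reducible_swap23:
  "reducible s1 s2 s3 s4 s5 s6 s7 \<longleftrightarrow> reducible s1 s3 s2 s6 s5 s4 s7"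
  unfolding reducible_def zeta3_trunc_swap23[of s1 s2 s3 s4 s5 s6 s7] by (simp add: ac_simps)

lemma reducible_m1_m2:
  assumes "1 \<le> s1" "1 \<le> s2" "reducible (s1 - 1) s2 s3 (Suc s4) s5 s6 s7"
    "reducible s1 (s2 - 1) s3 (Suc s4) s5 s6 s7"
  shows "reducible s1 s2 s3 s4 s5 s6 s7"
proof -
  obtain a b where s: "s1 = Suc a" "s2 = Suc b"
    using assms(1,2) by (auto simp: Suc_le_eq gr0_conv_Suc)
  show ?thesis
    unfolding reducible_def s zeta3_trunc_m1_m2 [abs_def]
    by (intro mhs_span.add) (use assms(3,4) in \<open>simp_all add: reducible_def s\<close>)
qed

lemma reducible_m1_m3:
  assumes "1 \<le> s1" "1 \<le> s3" "reducible (s1 - 1) s2 s3 s4 s5 (Suc s6) s7"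
    "reducible s1 s2 (s3 - 1) s4 s5 (Suc s6) s7"
  shows "reducible s1 s2 s3 s4 s5 s6 s7"
  by (rule reducible_swap23 [THEN iffD2], rule reducible_m1_m2
      [OF assms(1,2) assms(3,4) [THEN reducible_swap23 [THEN iffD1]]])

lemma reducible_m2_m3:
  assumes "1 \<le> s2" "1 \<le> s3" "reducible s1 (s2 - 1) s3 s4 (Suc s5) s6 s7"
    "reducible s1 s2 (s3 - 1) s4 (Suc s5) s6 s7"
  shows "reducible s1 s2 s3 s4 s5 s6 s7"
  by (rule reducible_swap12 [THEN iffD2], rule reducible_m1_m3
      [OF assms(1,2) assms(3,4) [THEN reducible_swap12 [THEN iffD1]]])

lemma reducible_m1_x23:
  assumes "1 \<le> s1" "1 \<le> s5" "reducible (s1 - 1) s2 s3 s4 s5 s6 (Suc s7)"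
    "reducible s1 s2 s3 s4 (s5 - 1) s6 (Suc s7)"
  shows "reducible s1 s2 s3 s4 s5 s6 s7"
proof -
  obtain a b where s: "s1 = Suc a" "s5 = Suc b"
    using assms(1,2) by (auto simp: Suc_le_eq gr0_conv_Suc)
  show ?thesis
    unfolding reducible_def s zeta3_trunc_m1_x23 [abs_def]
    by (intro mhs_span.add) (use assms(3,4) in \<open>simp_all add: reducible_def s\<close>)
qed

lemma reducible_m2_x13:
  assumes "1 \<le> s2" "1 \<le> s6" "reducible s1 (s2 - 1) s3 s4 s5 s6 (Suc s7)"
    "reducible s1 s2 s3 s4 s5 (s6 - 1) (Suc s7)"
  shows "reducible s1 s2 s3 s4 s5 s6 s7"
  by (rule reducible_swap12 [THEN iffD2], rule reducible_m1_x23
      [OF assms(1,2) assms(3,4) [THEN reducible_swap12 [THEN iffD1]]])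

lemma reducible_m3_x12:
  assumes "1 \<le> s3" "1 \<le> s4" "reducible s1 s2 (s3 - 1) s4 s5 s6 (Suc s7)"
    "reducible s1 s2 s3 (s4 - 1) s5 s6 (Suc s7)"
  shows "reducible s1 s2 s3 s4 s5 s6 s7"
  by (rule reducible_swap23 [THEN iffD2], rule reducible_m2_x13
      [OF assms(1,2) assms(3,4) [THEN reducible_swap23 [THEN iffD1]]])

lemma reducible_m1_m2_m3:
  assumes "1 \<le> s1" "1 \<le> s2" "1 \<le> s3" "reducible (s1 - 1) s2 s3 s4 s5 s6 (Suc s7)"
    "reducible s1 (s2 - 1) s3 s4 s5 s6 (Suc s7)" "reducible s1 s2 (s3 - 1) s4 s5 s6 (Suc s7)"
  shows "reducible s1 s2 s3 s4 s5 s6 s7"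
proof -
  obtain a b c where s: "s1 = Suc a" "s2 = Suc b" "s3 = Suc c"
    using assms(1,2,3) by (auto simp: Suc_le_eq gr0_conv_Suc)
  show ?thesis
    unfolding reducible_def s zeta3_trunc_m1_m2_m3 [abs_def]
    by (intro mhs_span.add mhs_span_diff) (use assms(4-6) in \<open>simp_all add: reducible_def s\<close>)
qed

lemma reducible_m1_x12_x13:
  assumes "1 \<le> s1" "1 \<le> s4" "1 \<le> s6" "reducible s1 s2 s3 (s4 - 1) s5 s6 (Suc s7)"
    "reducible s1 s2 s3 s4 s5 (s6 - 1) (Suc s7)" "reducible (s1 - 1) s2 s3 s4 s5 s6 (Suc s7)"
  shows "reducible s1 s2 s3 s4 s5 s6 s7"
proof -
  obtain a b c where s: "s1 = Suc a" "s4 = Suc b" "s6 = Suc c"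
    using assms(1,2,3) by (auto simp: Suc_le_eq gr0_conv_Suc)
  show ?thesis
    unfolding reducible_def s zeta3_trunc_m1_x12_x13 [abs_def]
    by (intro mhs_span.add mhs_span_diff) (use assms(4-6) in \<open>simp_all add: reducible_def s\<close>)
qed

lemma reducible_m2_x12_x23:
  assumes "1 \<le> s2" "1 \<le> s4" "1 \<le> s5" "reducible s1 s2 s3 (s4 - 1) s5 s6 (Suc s7)"
    "reducible s1 s2 s3 s4 (s5 - 1) s6 (Suc s7)" "reducible s1 (s2 - 1) s3 s4 s5 s6 (Suc s7)"
  shows "reducible s1 s2 s3 s4 s5 s6 s7"
  by (rule reducible_swap12 [THEN iffD2], rule reducible_m1_x12_x13
      [OF assms(1-3) assms(4-6) [THEN reducible_swap12 [THEN iffD1]]])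

lemma reducible_m3_x23_x13:
  assumes "1 \<le> s3" "1 \<le> s5" "1 \<le> s6" "reducible s1 s2 s3 s4 (s5 - 1) s6 (Suc s7)"
    "reducible s1 s2 s3 s4 s5 (s6 - 1) (Suc s7)" "reducible s1 s2 (s3 - 1) s4 s5 s6 (Suc s7)"
  shows "reducible s1 s2 s3 s4 s5 s6 s7"
  by (rule reducible_swap23 [THEN iffD2], rule reducible_m2_x12_x23
      [OF assms(1,3,2) assms(5,4,6) [THEN reducible_swap23 [THEN iffD1]]])

lemma reducible_x12_x23_x13:
  assumes "1 \<le> s4" "1 \<le> s5" "1 \<le> s6" "reducible s1 s2 s3 (s4 - 1) s5 s6 (Suc s7)"
    "reducible s1 s2 s3 s4 (s5 - 1) s6 (Suc s7)" "reducible s1 s2 s3 s4 s5 (s6 - 1) (Suc s7)"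
  shows "reducible s1 s2 s3 s4 s5 s6 s7"
proof -
  obtain a b c where s: "s4 = Suc a" "s5 = Suc b" "s6 = Suc c"
    using assms(1,2,3) by (auto simp: Suc_le_eq gr0_conv_Suc)
  have "(\<lambda>N. of_rat (1 / 2) * (2 * zeta3_trunc s1 s2 s3 s4 s5 s6 s7 N))
      \<in> mhs_span (words (s1 + s2 + s3 + s4 + s5 + s6 + s7) 3)"
    unfolding s zeta3_trunc_x12_x23_x13
    by (intro mhs_span.scale mhs_span.add) (use assms(4-6) in \<open>simp_all add: reducible_def s\<close>)
  then show ?thesis
    by (simp add: reducible_def of_rat_divide)
qed

lemma reducible_m1_x12:
  "1 \<le> s1 \<Longrightarrow> 1 \<le> s4 \<Longrightarrow> 1 \<le> s7 \<Longrightarrow> reducible s1 0 0 s4 0 0 s7"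
  unfolding reducible_def zeta3_trunc_chain by (rule mhs_span_word) auto

lemma reducible_x12_x23:
  "1 \<le> s4 \<Longrightarrow> 1 \<le> s5 \<Longrightarrow> 1 \<le> s7 \<Longrightarrow> reducible 0 0 0 s4 s5 0 s7"
  unfolding reducible_def using zeta3_trunc_x12_x23_in_span by simp

text \<open>Two orbits under permutation of the variables: a variable with a pair sum containing it
  (six patterns, nested sums) and two pair sums (three patterns, inclusion-exclusion).\<close>

lemma reducible_two_forms:
  assumes "1 \<le> a" "1 \<le> b" "1 \<le> e"
  shows "reducible a 0 0 b 0 0 e" "reducible 0 a 0 b 0 0 e" "reducible a 0 0 0 0 b e"
    "reducible 0 0 a 0 0 b e" "reducible 0 a 0 0 b 0 e" "reducible 0 0 a 0 b 0 e"
    "reducible 0 0 0 a b 0 e" "reducible 0 0 0 a 0 b e" "reducible 0 0 0 0 a b e"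
proof -
  note swap12 = reducible_swap12 [THEN iffD2] and swap23 = reducible_swap23 [THEN iffD2]
  show 1: "reducible a 0 0 b 0 0 e"
    using assms by (intro reducible_m1_x12)
  show 2: "reducible 0 a 0 b 0 0 e"
    by (rule swap12, rule 1)
  show 3: "reducible a 0 0 0 0 b e"
    by (rule swap23, rule 1)
  show "reducible 0 0 a 0 0 b e"
    by (rule swap23, rule 2)
  show 4: "reducible 0 a 0 0 b 0 e"
    by (rule swap12, rule 3)
  show "reducible 0 0 a 0 b 0 e"
    by (rule swap23, rule 4)
  show 5: "reducible 0 0 0 a b 0 e"
    using assms by (intro reducible_x12_x23)
  show "reducible 0 0 0 a 0 b e"
    by (rule swap12, rule 5)
  show "reducible 0 0 0 0 a b e"
    by (rule swap23, rule reducible_x12_x23) (use assms in simp_all)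
qed

text \<open>Modulo \<open>m1 + m2 + m3\<close> the six other linear forms become three parallel pairs
  \<open>m1\<close>, \<open>m2 + m3\<close> etc.; the series has rank 3 if at least two of these directions occur.\<close>

definition two_directions :: "nat \<Rightarrow> nat \<Rightarrow> nat \<Rightarrow> nat \<Rightarrow> nat \<Rightarrow> nat \<Rightarrow> bool" where
  "two_directions s1 s2 s3 s4 s5 s6 \<longleftrightarrow>
     (1 \<le> s1 + s5 \<and> 1 \<le> s2 + s6) \<or> (1 \<le> s1 + s5 \<and> 1 \<le> s3 + s4) \<or> (1 \<le> s2 + s6 \<and> 1 \<le> s3 + s4)"

text \<open>Every relation used preserves the two directions. Lowering one of two parallel forms
  leaves the other; among three forms of different directions two survive; and trading a power of
  \<open>m1\<close> or \<open>m2\<close> for one of \<open>m1 + m2\<close> keeps one old direction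
  and supplies the third.\<close>

lemma reducible_two_directions:
  assumes "1 \<le> s7" "two_directions s1 s2 s3 s4 s5 s6"
  shows "reducible s1 s2 s3 s4 s5 s6 s7"
  using assms
\<comment> \<open>The weights 3 > 2 > 1 make every relation decrease the measure: variables may turn
  into pair sums, and both may turn into \<open>m1 + m2 + m3\<close>.\<close>
proof (induction "3 * (s1 + s2 + s3) + 2 * (s4 + s5 + s6) + s7"
    arbitrary: s1 s2 s3 s4 s5 s6 s7 rule: less_induct)
  case less
  note IH = less.hyps
  have prems: "1 \<le> s7" "(s1 \<noteq> 0 \<or> s5 \<noteq> 0) \<and> (s2 \<noteq> 0 \<or> s6 \<noteq> 0) \<or>
      (s1 \<noteq> 0 \<or> s5 \<noteq> 0) \<and> (s3 \<noteq> 0 \<or> s4 \<noteq> 0) \<or> (s2 \<noteq> 0 \<or> s6 \<noteq> 0) \<and> (s3 \<noteq> 0 \<or> s4 \<noteq> 0)"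
    using less.prems by (auto simp: two_directions_def)
  \<comment> \<open>Once no two parallel forms occur, each direction is represented by a variable or
    by a pair sum. Either a three-term relation applies, or two variables occur without the third,
    or exactly one of the nine terminal pairs is left.\<close>
  consider "s1 \<noteq> 0" "s5 \<noteq> 0" | "s2 \<noteq> 0" "s6 \<noteq> 0" | "s3 \<noteq> 0" "s4 \<noteq> 0"
    | "s1 \<noteq> 0" "s2 \<noteq> 0" "s3 \<noteq> 0" | "s4 \<noteq> 0" "s5 \<noteq> 0" "s6 \<noteq> 0"
    | "s1 \<noteq> 0" "s4 \<noteq> 0" "s6 \<noteq> 0" | "s2 \<noteq> 0" "s4 \<noteq> 0" "s5 \<noteq> 0" | "s3 \<noteq> 0" "s5 \<noteq> 0" "s6 \<noteq> 0"
    | "s1 \<noteq> 0" "s2 \<noteq> 0" "s3 = 0" | "s1 \<noteq> 0" "s3 \<noteq> 0" "s2 = 0" | "s2 \<noteq> 0" "s3 \<noteq> 0" "s1 = 0"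
    | "s1 \<noteq> 0" "s4 \<noteq> 0" "s2 = 0 \<and> s3 = 0 \<and> s5 = 0 \<and> s6 = 0"
    | "s2 \<noteq> 0" "s4 \<noteq> 0" "s1 = 0 \<and> s3 = 0 \<and> s5 = 0 \<and> s6 = 0"
    | "s1 \<noteq> 0" "s6 \<noteq> 0" "s2 = 0 \<and> s3 = 0 \<and> s4 = 0 \<and> s5 = 0"
    | "s3 \<noteq> 0" "s6 \<noteq> 0" "s1 = 0 \<and> s2 = 0 \<and> s4 = 0 \<and> s5 = 0"
    | "s2 \<noteq> 0" "s5 \<noteq> 0" "s1 = 0 \<and> s3 = 0 \<and> s4 = 0 \<and> s6 = 0"
    | "s3 \<noteq> 0" "s5 \<noteq> 0" "s1 = 0 \<and> s2 = 0 \<and> s4 = 0 \<and> s6 = 0"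
    | "s4 \<noteq> 0" "s5 \<noteq> 0" "s1 = 0 \<and> s2 = 0 \<and> s3 = 0 \<and> s6 = 0"
    | "s4 \<noteq> 0" "s6 \<noteq> 0" "s1 = 0 \<and> s2 = 0 \<and> s3 = 0 \<and> s5 = 0"
    | "s5 \<noteq> 0" "s6 \<noteq> 0" "s1 = 0 \<and> s2 = 0 \<and> s3 = 0 \<and> s4 = 0"
    using prems(2)
    by (cases "s1 = 0"; cases "s2 = 0"; cases "s3 = 0"; cases "s4 = 0"; cases "s5 = 0"; cases "s6 = 0") simp_all
  then show ?case
  proof cases
    case 1
    show ?thesis
      by (rule reducible_m1_x23) (use 1 prems in \<open>auto intro!: IH simp: two_directions_def\<close>)
  next
    case 2
    show ?thesis
      by (rule reducible_m2_x13) (use 2 prems in \<open>auto intro!: IH simp: two_directions_def\<close>)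
  next
    case 3
    show ?thesis
      by (rule reducible_m3_x12) (use 3 prems in \<open>auto intro!: IH simp: two_directions_def\<close>)
  next
    case 4
    show ?thesis
      by (rule reducible_m1_m2_m3) (use 4 prems in \<open>auto intro!: IH simp: two_directions_def\<close>)
  next
    case 5
    show ?thesis
      by (rule reducible_x12_x23_x13) (use 5 prems in \<open>auto intro!: IH simp: two_directions_def\<close>)
  next
    case 6
    show ?thesis
      by (rule reducible_m1_x12_x13) (use 6 prems in \<open>auto intro!: IH simp: two_directions_def\<close>)
  next
    case 7
    show ?thesis
      by (rule reducible_m2_x12_x23) (use 7 prems in \<open>auto intro!: IH simp: two_directions_def\<close>)
  next
    case 8
    show ?thesis
      by (rule reducible_m3_x23_x13) (use 8 prems in \<open>auto intro!: IH simp: two_directions_def\<close>)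
  next
    case 9
    show ?thesis
      by (rule reducible_m1_m2) (use 9 prems in \<open>auto intro!: IH simp: two_directions_def\<close>)
  next
    case 10
    show ?thesis
      by (rule reducible_m1_m3) (use 10 prems in \<open>auto intro!: IH simp: two_directions_def\<close>)
  next
    case 11
    show ?thesis
      by (rule reducible_m2_m3) (use 11 prems in \<open>auto intro!: IH simp: two_directions_def\<close>)
  qed (use prems(1) reducible_two_forms in simp_all)
qed

text \<open>One relation that creates a power of \<open>m1 + m2 + m3\<close> is enough to reach the
  previous situation. If none applies, either some variable is absent from all forms or only two
  pair sums occur; the assumptions exclude both.\<close>

lemma reducible_s7_0:
  assumes "two_directions s1 s2 s3 s4 s5 s6"
    and "1 \<le> s1 + s4 + s6" "1 \<le> s2 + s4 + s5" "1 \<le> s3 + s5 + s6"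
    and "s1 + s2 + s3 \<noteq> 0 \<or> s4 \<noteq> 0 \<and> s5 \<noteq> 0 \<and> s6 \<noteq> 0"
  shows "reducible s1 s2 s3 s4 s5 s6 0"
proof -
  have prems: "(s1 \<noteq> 0 \<or> s5 \<noteq> 0) \<and> (s2 \<noteq> 0 \<or> s6 \<noteq> 0) \<or>
      (s1 \<noteq> 0 \<or> s5 \<noteq> 0) \<and> (s3 \<noteq> 0 \<or> s4 \<noteq> 0) \<or> (s2 \<noteq> 0 \<or> s6 \<noteq> 0) \<and> (s3 \<noteq> 0 \<or> s4 \<noteq> 0)"
    using assms(1) by (auto simp: two_directions_def)
  moreover have "s1 \<noteq> 0 \<or> s4 \<noteq> 0 \<or> s6 \<noteq> 0" "s2 \<noteq> 0 \<or> s4 \<noteq> 0 \<or> s5 \<noteq> 0" "s3 \<noteq> 0 \<or> s5 \<noteq> 0 \<or> s6 \<noteq> 0"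
      "s1 \<noteq> 0 \<or> s2 \<noteq> 0 \<or> s3 \<noteq> 0 \<or> s4 \<noteq> 0 \<and> s5 \<noteq> 0 \<and> s6 \<noteq> 0"
    using assms(2-) by auto
  ultimately consider "s1 \<noteq> 0" "s5 \<noteq> 0" | "s2 \<noteq> 0" "s6 \<noteq> 0" | "s3 \<noteq> 0" "s4 \<noteq> 0"
    | "s1 \<noteq> 0" "s2 \<noteq> 0" "s3 \<noteq> 0" | "s4 \<noteq> 0" "s5 \<noteq> 0" "s6 \<noteq> 0"
    | "s1 \<noteq> 0" "s4 \<noteq> 0" "s6 \<noteq> 0" | "s2 \<noteq> 0" "s4 \<noteq> 0" "s5 \<noteq> 0" | "s3 \<noteq> 0" "s5 \<noteq> 0" "s6 \<noteq> 0"
    by (cases "s1 = 0"; cases "s2 = 0"; cases "s3 = 0"; cases "s4 = 0"; cases "s5 = 0"; cases "s6 = 0") simp_all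
  then show ?thesis
  proof cases
    case 1
    show ?thesis
      by (rule reducible_m1_x23) (use 1 prems in \<open>auto intro!: reducible_two_directions simp: two_directions_def\<close>)
  next
    case 2
    show ?thesis
      by (rule reducible_m2_x13) (use 2 prems in \<open>auto intro!: reducible_two_directions simp: two_directions_def\<close>)
  next
    case 3
    show ?thesis
      by (rule reducible_m3_x12) (use 3 prems in \<open>auto intro!: reducible_two_directions simp: two_directions_def\<close>)
  next
    case 4
    show ?thesis
      by (rule reducible_m1_m2_m3) (use 4 prems in \<open>auto intro!: reducible_two_directions simp: two_directions_def\<close>)
  next
    case 5
    show ?thesis
      by (rule reducible_x12_x23_x13) (use 5 prems in \<open>auto intro!: reducible_two_directions simp: two_directions_def\<close>)
  next
    case 6
    show ?thesis
      by (rule reducible_m1_x12_x13) (use 6 prems in \<open>auto intro!: reducible_two_directions simp: two_directions_def\<close>)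
  next
    case 7
    show ?thesis
      by (rule reducible_m2_x12_x23) (use 7 prems in \<open>auto intro!: reducible_two_directions simp: two_directions_def\<close>)
  next
    case 8
    show ?thesis
      by (rule reducible_m3_x23_x13) (use 8 prems in \<open>auto intro!: reducible_two_directions simp: two_directions_def\<close>)
  qed
qed

section \<open>Necessary conditions for convergence\<close>

lemma incseq_triples: "incseq triples"
  by (auto simp: incseq_def triples_def)

lemma UN_triples: "(\<Union>N. triples N) = pos_triples"
proof (intro equalityI subsetI)
  fix t assume "t \<in> pos_triples"
  then obtain a b c where "t = (a, b, c)" "1 \<le> a" "1 \<le> b" "1 \<le> c"
    by (auto simp: pos_triples_def)
  then have "t \<in> triples (a + b + c)"
    by (simp add: triples_def)
  then show "t \<in> (\<Union>N. triples N)"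
    by blast
qed (auto simp: triples_def pos_triples_def)

lemma zeta3_trunc_tendsto:
  assumes "zeta3_converges s1 s2 s3 s4 s5 s6 s7"
  shows "zeta3_trunc s1 s2 s3 s4 s5 s6 s7 \<longlonglongrightarrow> zeta3 s1 s2 s3 s4 s5 s6 s7"
  using sum_tendsto_infsum_incseq[OF assms[unfolded zeta3_converges_def] finite_triples incseq_triples UN_triples]
  by (simp add: zeta3_def zeta3_trunc_def [abs_def])

lemma zeta3_converges_swap12:
  "zeta3_converges s1 s2 s3 s4 s5 s6 s7 \<longleftrightarrow> zeta3_converges s2 s1 s3 s4 s6 s5 s7"
  unfolding zeta3_converges_def
  by (rule summable_on_reindex_bij_witness[of _ "\<lambda>(a, b, c). (b, a, c)" "\<lambda>(a, b, c). (b, a, c)"])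
    (auto simp: pos_triples_def zeta3_term_def ac_simps)

lemma zeta3_converges_swap23:
  "zeta3_converges s1 s2 s3 s4 s5 s6 s7 \<longleftrightarrow> zeta3_converges s1 s3 s2 s6 s5 s4 s7"
  unfolding zeta3_converges_def
  by (rule summable_on_reindex_bij_witness[of _ "\<lambda>(a, b, c). (a, c, b)" "\<lambda>(a, b, c). (a, c, b)"])
    (auto simp: pos_triples_def zeta3_term_def ac_simps)

lemma zeta3_swap12: "zeta3 s1 s2 s3 s4 s5 s6 s7 = zeta3 s2 s1 s3 s4 s6 s5 s7"
  unfolding zeta3_def
  by (rule infsum_reindex_bij_witness[of _ "\<lambda>(a, b, c). (b, a, c)" "\<lambda>(a, b, c). (b, a, c)"])
    (auto simp: pos_triples_def zeta3_term_def ac_simps)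

lemma zeta3_swap23: "zeta3 s1 s2 s3 s4 s5 s6 s7 = zeta3 s1 s3 s2 s6 s5 s4 s7"
  unfolding zeta3_def
  by (rule infsum_reindex_bij_witness[of _ "\<lambda>(a, b, c). (a, c, b)" "\<lambda>(a, b, c). (a, c, b)"])
    (auto simp: pos_triples_def zeta3_term_def ac_simps)

lemma zeta3_term_nonneg: "zeta3_term s1 s2 s3 s4 s5 s6 s7 t \<ge> 0"
  by (cases t) (simp add: zeta3_term_def)

text \<open>A Cauchy criterion: a convergent series cannot have mass \<open>c\<close> outside every
  truncation.\<close>

lemma zeta3_diverges_if_blocks:
  assumes "c > 0" "\<And>M. M \<ge> 1 \<Longrightarrow> finite (B M)" "\<And>M. M \<ge> 1 \<Longrightarrow> B M \<subseteq> pos_triples - triples M"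
    and "\<And>M. M \<ge> 1 \<Longrightarrow> c \<le> sum (zeta3_term s1 s2 s3 s4 s5 s6 s7) (B M)"
  shows "\<not> zeta3_converges s1 s2 s3 s4 s5 s6 s7"
proof
  let ?f = "zeta3_term s1 s2 s3 s4 s5 s6 s7"
  assume conv: "zeta3_converges s1 s2 s3 s4 s5 s6 s7"
  let ?L = "zeta3 s1 s2 s3 s4 s5 s6 s7"
  have "zeta3_trunc s1 s2 s3 s4 s5 s6 s7 M \<le> ?L - c" if "M \<ge> 1" for M
  proof -
    have "sum ?f (triples M \<union> B M) \<le> ?L"
      unfolding zeta3_def
    proof (rule finite_sum_le_infsum)
      show "?f summable_on pos_triples"
        using conv by (simp add: zeta3_converges_def)
      show "triples M \<union> B M \<subseteq> pos_triples"
        using assms(3)[OF that] UN_triples by blast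
    qed (use that assms finite_triples in \<open>auto simp: zeta3_term_nonneg\<close>)
    moreover have "sum ?f (triples M \<union> B M) = sum ?f (triples M) + sum ?f (B M)"
      using assms(2,3)[OF that] by (intro sum.union_disjoint finite_triples) auto
    ultimately show ?thesis
      using assms(4)[OF that] by (simp add: zeta3_trunc_def)
  qed
  then have "?L \<le> ?L - c"
    by (intro LIMSEQ_le_const2[OF zeta3_trunc_tendsto[OF conv]]) blast
  with \<open>c > 0\<close> show False
    by simp
qed

text \<open>With \<open>m2 = m3 = 1\<close> the term decays in \<open>m1\<close> only like the power
  \<open>s1 + s4 + s6 + s7\<close>, so exponent at most 1 leaves a harmonic-type series.\<close>

lemma zeta3_converges_m1:
  assumes "zeta3_converges s1 s2 s3 s4 s5 s6 s7"
  shows "2 \<le> s1 + s4 + s6 + s7"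
proof (rule ccontr)
  assume "\<not> ?thesis"
  then have q: "s1 + s4 + s6 + s7 \<le> 1"
    by simp
  have "\<not> zeta3_converges s1 s2 s3 s4 s5 s6 s7"
  proof (rule zeta3_diverges_if_blocks)
    \<comment> \<open>All forms that grow with m are at most 4M, while \<open>m2 + m3 = 2\<close>
      contributes \<open>2 ^ s5\<close>; the M points of the block make up for the single factor
      M.\<close>
    let ?B = "\<lambda>M. (\<lambda>m. (m, 1, 1)) ` {M + 1..2 * M}" and ?c = "1 / (4 * 2 ^ s5) :: real"
    show "?c \<le> sum (zeta3_term s1 s2 s3 s4 s5 s6 s7) (?B M)" if "M \<ge> 1" for M
    proof -
      have "1 / (2 ^ s5 * (4 * real M)) \<le> zeta3_term s1 s2 s3 s4 s5 s6 s7 (m, 1, 1)"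
        if m: "m \<in> {M + 1..2 * M}" for m
      proof -
        have "real m ^ s1 * real (m + 1) ^ s4 * real (m + 1) ^ s6 * real (m + 2) ^ s7
            \<le> (4 * real M) ^ s1 * (4 * real M) ^ s4 * (4 * real M) ^ s6 * (4 * real M) ^ s7"
          using m by (intro mult_mono power_mono) auto
        also have "\<dots> = (4 * real M) ^ (s1 + s4 + s6 + s7)"
          by (simp add: power_add)
        also have "\<dots> \<le> (4 * real M) ^ 1"
          using q \<open>M \<ge> 1\<close> by (intro power_increasing) auto
        finally have "2 ^ s5 * (real m ^ s1 * real (m + 1) ^ s4 * real (m + 1) ^ s6 * real (m + 2) ^ s7)
            \<le> 2 ^ s5 * (4 * real M)"
          by simp
        then have "1 / (2 ^ s5 * (4 * real M)) \<le>
            1 / (2 ^ s5 * (real m ^ s1 * real (m + 1) ^ s4 * real (m + 1) ^ s6 * real (m + 2) ^ s7))"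
          using m by (intro divide_left_mono) auto
        then show ?thesis
          by (simp add: zeta3_term_def ac_simps)
      qed
      then have "(\<Sum>m\<in>{M + 1..2 * M}. 1 / (2 ^ s5 * (4 * real M)))
          \<le> (\<Sum>m\<in>{M + 1..2 * M}. zeta3_term s1 s2 s3 s4 s5 s6 s7 (m, 1, 1))"
        by (rule sum_mono)
      then show ?thesis
        using that by (simp add: sum.reindex inj_on_def)
    qed
  qed (auto simp: pos_triples_def triples_def)
  with assms show False
    by blast
qed

lemma zeta3_converges_m2:
  assumes "zeta3_converges s1 s2 s3 s4 s5 s6 s7"
  shows "2 \<le> s2 + s4 + s5 + s7"
  using zeta3_converges_m1[OF assms[unfolded zeta3_converges_swap12[of s1 s2 s3 s4 s5 s6 s7]]] .

lemma zeta3_converges_m3: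
  assumes "zeta3_converges s1 s2 s3 s4 s5 s6 s7"
  shows "2 \<le> s3 + s5 + s6 + s7"
  using zeta3_converges_m2[OF assms[unfolded zeta3_converges_swap23[of s1 s2 s3 s4 s5 s6 s7]]] by simp

lemma zeta3_converges_m2_m3:
  assumes "zeta3_converges s1 s2 s3 s4 s5 s6 s7"
  shows "3 \<le> s2 + s3 + s4 + s5 + s6 + s7"
proof (rule ccontr)
  assume "\<not> ?thesis"
  then have q: "s2 + s3 + s4 + s5 + s6 + s7 \<le> 2"
    by simp
  have "\<not> zeta3_converges s1 s2 s3 s4 s5 s6 s7"
  proof (rule zeta3_diverges_if_blocks)
    \<comment> \<open>With \<open>m1 = 1\<close> every other form is at most 6M, and the block has
      M^2 points, so exponent at most 2 leaves mass at least 1/36.\<close>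
    let ?B = "\<lambda>M. {1 :: nat} \<times> {M + 1..2 * M} \<times> {M + 1..2 * M}" and ?c = "1 / 36 :: real"
    show "?c \<le> sum (zeta3_term s1 s2 s3 s4 s5 s6 s7) (?B M)" if "M \<ge> 1" for M
    proof -
      have "1 / (6 * real M) ^ 2 \<le> zeta3_term s1 s2 s3 s4 s5 s6 s7 t" if t_in: "t \<in> ?B M" for t
      proof -
        obtain m k where t: "t = (1, m, k)" and mk: "m \<in> {M + 1..2 * M}" "k \<in> {M + 1..2 * M}"
          using t_in by auto
        have "real m ^ s2 * real k ^ s3 * real (1 + m) ^ s4 * real (m + k) ^ s5 * real (1 + k) ^ s6
              * real (1 + m + k) ^ s7
            \<le> (6 * real M) ^ s2 * (6 * real M) ^ s3 * (6 * real M) ^ s4 * (6 * real M) ^ s5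
              * (6 * real M) ^ s6 * (6 * real M) ^ s7"
          using mk by (intro mult_mono power_mono) auto
        also have "\<dots> = (6 * real M) ^ (s2 + s3 + s4 + s5 + s6 + s7)"
          by (simp add: power_add)
        also have "\<dots> \<le> (6 * real M) ^ 2"
          using q \<open>M \<ge> 1\<close> by (intro power_increasing) auto
        finally have "1 / (6 * real M) ^ 2 \<le> 1 / (real m ^ s2 * real k ^ s3 * real (1 + m) ^ s4
            * real (m + k) ^ s5 * real (1 + k) ^ s6 * real (1 + m + k) ^ s7)"
          using mk by (intro divide_left_mono) auto
        then show ?thesis
          by (simp add: t zeta3_term_def add.assoc)
      qed
      then have "(\<Sum>t\<in>?B M. 1 / (6 * real M) ^ 2) \<le> sum (zeta3_term s1 s2 s3 s4 s5 s6 s7) (?B M)"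
        by (rule sum_mono)
      then show ?thesis
        using that by (simp add: power2_eq_square)
    qed
  qed (auto simp: pos_triples_def triples_def)
  with assms show False
    by blast
qed

section \<open>Irregular values\<close>

text \<open>Natural subtraction is harmless for small \<open>w\<close>, since there are no words of
  weight 0.\<close>

definition mixed_words :: "nat \<Rightarrow> nat list set" where
  "mixed_words w = words w 3 \<union> words (w - 1) 2 \<union> words (w - 2) 1"

lemma mhs_span_mixed:
  "f \<in> mhs_span (words w d) \<Longrightarrow> d \<le> 3 \<Longrightarrow> f \<in> mhs_span (mixed_words w)"
  "f \<in> mhs_span (words (w - 1) d) \<Longrightarrow> d \<le> 2 \<Longrightarrow> f \<in> mhs_span (mixed_words w)"
  "f \<in> mhs_span (words (w - 2) 1) \<Longrightarrow> f \<in> mhs_span (mixed_words w)"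
  by (erule mhs_span_mono; auto simp: mixed_words_def words_def)+

lemma mixed_limit:
  assumes "f \<in> mhs_span (mixed_words w)" "f \<longlonglongrightarrow> L"
  shows "L \<in> rat_span (MZVs w 3 \<union> MZVs (w - 1) 2 \<union> MZVs (w - 2) 1)"
proof -
  let ?I = "{(w, 3), (w - 1, 2), (w - 2, 1)} :: (nat \<times> nat) set"
  have "f \<in> mhs_span (\<Union>(w, d)\<in>?I. words w d)"
    using assms(1) by (simp add: mixed_words_def Un_assoc)
  moreover have "d \<le> 3" if "(v, d) \<in> ?I" for v d
    using that by auto
  ultimately have "L \<in> rat_span (\<Union>(w, d)\<in>?I. MZVs w d)"
    using assms(2) by (rule mhs_span_words_limit)
  then show ?thesis
    by (simp add: Un_assoc)
qed

text \<open>The variables \<open>m2\<close> and \<open>m3\<close> enter only through y =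
  \<open>m2 + m3\<close>, which has y - 1 decompositions.\<close>

lemma zeta3_trunc_m1_x23_s7_eq:
  "zeta3_trunc a 0 0 0 p 0 e N =
     (\<Sum>(m, y)\<in>pairs N. (real y - 1) / (real m ^ a * real y ^ p * real (m + y) ^ e))"
proof -
  have fin: "finite (pairs N)"
    by (rule finite_subset[of _ "{..N} \<times> {..N}"]) (auto simp: pairs_def)
  have "(\<Sum>(m, y)\<in>pairs N. (real y - 1) / (real m ^ a * real y ^ p * real (m + y) ^ e))
      = (\<Sum>t\<in>pairs N. \<Sum>k\<in>{1..<snd t}. 1 / (real (fst t) ^ a * real (snd t) ^ p * real (fst t + snd t) ^ e))"
    by (intro sum.cong) (auto simp: pairs_def of_nat_diff)
  also have "\<dots> = (\<Sum>(t, k)\<in>Sigma (pairs N) (\<lambda>t. {1..<snd t}).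
      1 / (real (fst t) ^ a * real (snd t) ^ p * real (fst t + snd t) ^ e))"
    using fin by (subst sum.Sigma) auto
  also have "\<dots> = zeta3_trunc a 0 0 0 p 0 e N"
    unfolding zeta3_trunc_def
    by (rule sum.reindex_bij_witness[of _ "\<lambda>(m1, m2, m3). ((m1, m2 + m3), m2)"
          "\<lambda>(t, k). (fst t, k, snd t - k)"])
      (auto simp: pairs_def triples_def zeta3_term_def of_nat_diff)
  finally show ?thesis ..
qed

text \<open>The numerator y - 1 is absorbed by a power of y if there is one, and otherwise written
  as (m + y) - m - 1; each absorbed factor costs one unit of weight. The two bounds are those forced
  by convergence.\<close>

lemma zeta3_trunc_m1_x23_s7_mixed:
  assumes "2 \<le> a + e" "3 \<le> p + e"
  shows "zeta3_trunc a 0 0 0 p 0 e \<in> mhs_span (mixed_words (a + p + e))"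
proof (cases "p \<ge> 1")
  case True
  have "zeta3_trunc a 0 0 0 p 0 e = (\<lambda>N. pair_sum a (p - 1) e N - pair_sum a p e N)"
  proof
    fix N
    have "(real y - 1) / (real m ^ a * real y ^ p * real (m + y) ^ e)
        = 1 / (real m ^ a * real y ^ (p - 1) * real (m + y) ^ e) - 1 / (real m ^ a * real y ^ p * real (m + y) ^ e)"
      if "(m, y) \<in> pairs N" for m y
      using that True by (cases p) (auto simp: pairs_def diff_divide_distrib)
    then show "zeta3_trunc a 0 0 0 p 0 e N = pair_sum a (p - 1) e N - pair_sum a p e N"
      unfolding zeta3_trunc_m1_x23_s7_eq pair_sum_def sum_subtractf [symmetric]
      by (intro sum.cong) auto
  qed
  moreover have "pair_sum a p e \<in> mhs_span (mixed_words (a + p + e))"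
    using True assms by (intro mhs_span_mixed(1)[OF pair_sum_in_span]) auto
  moreover have "pair_sum a (p - 1) e \<in> mhs_span (mixed_words (a + p + e))"
  proof (cases "a = 0 \<and> p = 1")
    \<comment> \<open>No power of either variable is left, so a second summation merely counts and
      the weight drops to \<open>e - 1\<close>, two below the original.\<close>
    case True
    then have "e \<ge> 2"
      using assms by simp
    have "(\<lambda>N. mhs [e - 1] N - mhs [e] N) \<in> mhs_span (mixed_words (a + p + e))"
      using True \<open>e \<ge> 2\<close>
      by (intro mhs_span_diff mhs_span_mixed(3)[OF mhs_span_word] mhs_span_mixed(2)[OF mhs_span_word, of _ _ 1]) auto
    then show ?thesis
      using True \<open>e \<ge> 2\<close> by (simp add: pair_sum_0_0)
  next
    case False
    have "pair_sum a (p - 1) e \<in> mhs_span (words (a + (p - 1) + e) 2)"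
      using True False assms by (intro pair_sum_in_span) auto
    also have "a + (p - 1) + e = a + p + e - 1"
      using True by simp
    finally show ?thesis
      by (rule mhs_span_mixed(2)) simp
  qed
  ultimately show ?thesis
    by (simp add: mhs_span_diff)
next
  case False
  with assms have p: "p = 0" and e: "e \<ge> 3"
    by auto
  show ?thesis
  proof (cases "a = 0")
    case True
    have "zeta3_trunc a 0 0 0 p 0 e
        = (\<lambda>N. of_rat (1 / 2) * (mhs [e - 2] N - of_rat 3 * mhs [e - 1] N + of_rat 2 * mhs [e] N))"
    proof
      fix N
      obtain k where k: "e = Suc (Suc k)"
        using e by (cases e; cases "e - 1") auto
      \<comment> \<open>This counts the ordered decompositions of S = n + 1 into three positive
        parts. It equals (S^2 - 3 S + 2) / 2, whose three terms lower the weight by two, one and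
        zero.\<close>
      have tri: "mhs [0, 0] n = real n * (real n - 1) / 2" for n
      proof -
        have "mhs [0, 0] n = (\<Sum>i<n. real i)"
          by simp
        also have "\<dots> = real n * (real n - 1) / 2"
          by (induction n) (auto simp: field_simps)
        finally show ?thesis .
      qed
      have summand: "mhs [0, 0] n / real (Suc n) ^ e =
          1 / 2 * (1 / real (Suc n) ^ k - 3 * (1 / real (Suc n) ^ Suc k) + 2 * (1 / real (Suc n) ^ e))" for n
      proof -
        let ?S = "real (Suc n)"
        have "real n * (real n - 1) = ?S ^ 2 - 3 * ?S + 2"
          by (simp add: power2_eq_square algebra_simps)
        then have "mhs [0, 0] n / ?S ^ e = 1 / 2 * ((?S ^ 2 - 3 * ?S + 2) / ?S ^ e)"
          unfolding tri by simp
        also have "(?S ^ 2 - 3 * ?S + 2) / ?S ^ e = ?S ^ 2 / ?S ^ e - 3 * (?S / ?S ^ e) + 2 * (1 / ?S ^ e)"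
          by (simp only: add_divide_distrib diff_divide_distrib mult_1_right times_divide_eq_right)
        also have "?S ^ 2 / ?S ^ e = 1 / ?S ^ k"
          by (simp add: k power2_eq_square del: of_nat_Suc)
        also have "?S / ?S ^ e = 1 / ?S ^ Suc k"
          by (simp add: k del: of_nat_Suc)
        finally show ?thesis .
      qed
      have "zeta3_trunc a 0 0 0 p 0 e N = (\<Sum>n<N. mhs [0, 0] n / real (Suc n) ^ e)"
        unfolding True p zeta3_trunc_chain by (rule mhs.simps(2))
      also have "\<dots>
          = of_rat (1 / 2) * (mhs [e - 2] N - of_rat 3 * mhs [e - 1] N + of_rat 2 * mhs [e] N)"
        unfolding summand sum_distrib_left [symmetric] sum.distrib sum_subtractf
        by (simp add: k of_rat_divide del: of_nat_Suc power_Suc)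
      finally show "zeta3_trunc a 0 0 0 p 0 e N
          = of_rat (1 / 2) * (mhs [e - 2] N - of_rat 3 * mhs [e - 1] N + of_rat 2 * mhs [e] N)" .
    qed
    also have "\<dots> \<in> mhs_span (mixed_words (a + p + e))"
      using True p e
      by (intro mhs_span.scale mhs_span.add mhs_span_diff mhs_span_mixed(3)[OF mhs_span_word]
          mhs_span_mixed(2)[OF mhs_span_word, of _ _ 1] mhs_span_mixed(1)[OF mhs_span_word, of _ _ 1]) auto
    finally show ?thesis .
  next
    case False
    have "zeta3_trunc a 0 0 0 p 0 e = (\<lambda>N. pair_sum a 0 (e - 1) N - pair_sum (a - 1) 0 e N - pair_sum a 0 e N)"
    proof
      fix N
      obtain b k where bk: "a = Suc b" "e = Suc k"
        using False e by (cases a; cases e) auto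
      have "(real y - 1) / (real m ^ a * real y ^ p * real (m + y) ^ e)
          = 1 / (real m ^ a * real y ^ 0 * real (m + y) ^ (e - 1)) - 1 / (real m ^ (a - 1) * real y ^ 0 * real (m + y) ^ e)
            - 1 / (real m ^ a * real y ^ 0 * real (m + y) ^ e)"
        if "(m, y) \<in> pairs N" for m y
      proof -
        have "m > 0"
          using that by (auto simp: pairs_def)
        define S where "S = real (m + y)"
        have S: "S \<noteq> 0" "real y = S - real m"
          using \<open>m > 0\<close> by (auto simp: S_def)
        show ?thesis
          unfolding S_def [symmetric] using \<open>m > 0\<close> S(1) by (simp add: S(2) bk p diff_divide_distrib)
      qed
      then show "zeta3_trunc a 0 0 0 p 0 e N = pair_sum a 0 (e - 1) N - pair_sum (a - 1) 0 e N - pair_sum a 0 e N"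
        unfolding zeta3_trunc_m1_x23_s7_eq pair_sum_def sum_subtractf [symmetric]
        by (intro sum.cong) auto
    qed
    moreover have "pair_sum a 0 (e - 1) \<in> mhs_span (mixed_words (a + p + e))"
      using mhs_span_mixed(2)[of _ "a + p + e" 2] pair_sum_in_span[of a 0 "e - 1"] False e p by auto
    moreover have "pair_sum a 0 e \<in> mhs_span (mixed_words (a + p + e))"
      using mhs_span_mixed(1)[of _ "a + p + e" 2] pair_sum_in_span[of a 0 e] False e p by auto
    moreover have "pair_sum (a - 1) 0 e \<in> mhs_span (mixed_words (a + p + e))"
    proof (cases "a = 1")
      case True
      have "(\<lambda>N. mhs [e - 1] N - mhs [e] N) \<in> mhs_span (mixed_words (a + p + e))"
        using True e p
        by (intro mhs_span_diff mhs_span_mixed(3)[OF mhs_span_word] mhs_span_mixed(2)[OF mhs_span_word, of _ _ 1]) auto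
      then show ?thesis
        using True e by (simp add: pair_sum_0_0)
    next
      case a: False
      have "pair_sum (a - 1) 0 e \<in> mhs_span (words (a - 1 + 0 + e) 2)"
        using False a e by (intro pair_sum_in_span) auto
      also have "a - 1 + 0 + e = a + p + e - 1"
        using False p by simp
      finally show ?thesis
        by (rule mhs_span_mixed(2)) simp
    qed
    ultimately show ?thesis
      by (simp add: mhs_span_diff)
  qed
qed

text \<open>A last exponent 0 counts the positive integers below the preceding index and so cancels
  one of its powers, up to a correction.\<close>

lemma mhs_Suc_0:
  assumes "q \<ge> 1"
  shows "mhs [p, Suc q, 0] N = mhs [p, q] N - mhs [p, Suc q] N"
proof -
  have "mhs [Suc q, 0] n = mhs [q] n - mhs [Suc q] n" for n
    using assms by (simp add: pair_sum_eq_mhs [symmetric] pair_sum_0_0 del: mhs.simps)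
  then show ?thesis
    by (simp only: mhs.simps(2)[of p] diff_divide_distrib sum_subtractf)
qed

text \<open>Truncating at \<open>m1 + m2, m2 + m3 \<le> N\<close> turns this series into nested sums.\<close>

lemma zeta3_x12_x23_mixed:
  assumes "zeta3_converges 0 0 0 p q 0 0"
  shows "zeta3 0 0 0 p q 0 0 \<in> rat_span (MZVs (p + q) 3 \<union> MZVs (p + q - 1) 2 \<union> MZVs (p + q - 2) 1)"
proof (rule mixed_limit)
  define B where "B = (\<lambda>N. {(m1, m2, m3). 1 \<le> m1 \<and> 1 \<le> m2 \<and> 1 \<le> m3 \<and> m1 + m2 \<le> N \<and> m2 + m3 \<le> (N::nat)})"
  define f where "f = zeta3_term 0 0 0 p q 0 0"
  have finite_B: "finite (B N)" for N
    by (rule finite_subset[of _ "{..N} \<times> {..N} \<times> {..N}"]) (auto simp: B_def)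
  show "(\<lambda>N. sum f (B N)) \<longlonglongrightarrow> zeta3 0 0 0 p q 0 0"
    unfolding zeta3_def f_def
  proof (rule sum_tendsto_infsum_incseq[OF _ finite_B])
    show "(\<Union>N. B N) = pos_triples"
    proof (intro equalityI subsetI)
      fix t assume "t \<in> pos_triples"
      then obtain N where "t \<in> triples N"
        using UN_triples by blast
      then have "t \<in> B N"
        by (auto simp: B_def triples_def)
      then show "t \<in> (\<Union>N. B N)"
        by blast
    qed (auto simp: B_def pos_triples_def)
  qed (use assms in \<open>auto simp: zeta3_converges_def incseq_def B_def\<close>)
  \<comment> \<open>Hence \<open>p - 1\<close> and \<open>q - 1\<close>, which appear after the
    weight drop, are still positive exponents.\<close>
  have p: "2 \<le> p" and q: "2 \<le> q"
    using zeta3_converges_m1[OF assms] zeta3_converges_m3[OF assms] by auto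
  have "sum f (B N) = mhs [p, q, 0] N + mhs [q, p, 0] N + mhs [p + q, 0] N" for N
  proof -
    \<comment> \<open>Comparing \<open>m1\<close> with \<open>m3\<close> is comparing
      \<open>m1 + m2\<close> with \<open>m2 + m3\<close>. In each part \<open>m2\<close> ranges
      freely below the smaller of these sums, which is the exponent 0.\<close>
    have "B N = {(m1, m2, m3) \<in> B N. m1 > m3} \<union> {(m1, m2, m3) \<in> B N. m1 < m3} \<union> {(m1, m2, m3) \<in> B N. m1 = m3}"
      by auto
    then have "sum f (B N) = sum f ({(m1, m2, m3) \<in> B N. m1 > m3} \<union> {(m1, m2, m3) \<in> B N. m1 < m3}
        \<union> {(m1, m2, m3) \<in> B N. m1 = m3})"
      by (rule arg_cong)
    also have "\<dots> = sum f {(m1, m2, m3) \<in> B N. m1 > m3} + sum f {(m1, m2, m3) \<in> B N. m1 < m3}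
        + sum f {(m1, m2, m3) \<in> B N. m1 = m3}"
      by (subst sum.union_disjoint, (auto intro: finite_subset[OF _ finite_B])[3],
          subst sum.union_disjoint, auto intro: finite_subset[OF _ finite_B])
    also have "sum f {(m1, m2, m3) \<in> B N. m1 > m3} = mhs [p, q, 0] N"
    proof -
      have "mhs [p, q, 0] N = (\<Sum>(n, k, j)\<in>Sigma {..<N} (\<lambda>n. Sigma {..<n} lessThan).
          1 / real (Suc k) ^ q / real (Suc n) ^ p)"
        by (simp add: sum.Sigma [symmetric] sum_divide_distrib del: of_nat_Suc)
      also have "\<dots> = sum f {(m1, m2, m3) \<in> B N. m1 > m3}"
        by (rule sum.reindex_bij_witness[of _ "\<lambda>(m1, m2, m3). (m1 + m2 - 1, m2 + m3 - 1, m2 - 1)"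
              "\<lambda>(n, k, j). (n - j, Suc j, k - j)"])
          (auto simp: B_def f_def zeta3_term_def of_nat_diff, simp add: add.commute)
      finally show ?thesis ..
    qed
    also have "sum f {(m1, m2, m3) \<in> B N. m1 < m3} = mhs [q, p, 0] N"
    proof -
      have "mhs [q, p, 0] N = (\<Sum>(n, k, j)\<in>Sigma {..<N} (\<lambda>n. Sigma {..<n} lessThan).
          1 / real (Suc k) ^ p / real (Suc n) ^ q)"
        by (simp add: sum.Sigma [symmetric] sum_divide_distrib del: of_nat_Suc)
      also have "\<dots> = sum f {(m1, m2, m3) \<in> B N. m1 < m3}"
        by (rule sum.reindex_bij_witness[of _ "\<lambda>(m1, m2, m3). (m2 + m3 - 1, m1 + m2 - 1, m2 - 1)"
              "\<lambda>(n, k, j). (k - j, Suc j, n - j)"])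
          (auto simp: B_def f_def zeta3_term_def of_nat_diff, simp add: add.commute)
      finally show ?thesis ..
    qed
    also have "sum f {(m1, m2, m3) \<in> B N. m1 = m3} = mhs [p + q, 0] N"
    proof -
      have "mhs [p + q, 0] N = (\<Sum>(n, j)\<in>Sigma {..<N} lessThan. 1 / real (Suc n) ^ (p + q))"
        by (simp add: sum.Sigma [symmetric] sum_divide_distrib del: of_nat_Suc)
      also have "\<dots> = sum f {(m1, m2, m3) \<in> B N. m1 = m3}"
        by (rule sum.reindex_bij_witness[of _ "\<lambda>(m1, m2, m3). (m1 + m2 - 1, m2 - 1)"
              "\<lambda>(n, j). (n - j, Suc j, n - j)"])
          (auto simp: B_def f_def zeta3_term_def of_nat_diff power_add, simp add: add.commute)
      finally show ?thesis ..
    qed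
    finally show ?thesis .
  qed
  moreover obtain p' q' where pq: "p = Suc p'" "q = Suc q'" "p' \<ge> 1" "q' \<ge> 1"
    using p q by (cases p; cases q) auto
  moreover have "mhs [p + q, 0] = (\<lambda>N. mhs [p + q - 1] N - mhs [p + q] N)"
    using p by (simp add: pair_sum_eq_mhs [symmetric] pair_sum_0_0)
  ultimately have "(\<lambda>N. sum f (B N)) = (\<lambda>N. (mhs [p, q - 1] N - mhs [p, q] N) + (mhs [q, p - 1] N - mhs [q, p] N)
      + (mhs [p + q - 1] N - mhs [p + q] N))"
    by (simp add: mhs_Suc_0 del: mhs.simps)
  also have "\<dots> \<in> mhs_span (mixed_words (p + q))"
    using p q
    by (intro mhs_span_diff mhs_span.add mhs_span_mixed(1)[OF mhs_span_word, of _ _ 2]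
        mhs_span_mixed(2)[OF mhs_span_word, of _ _ 2]) auto
  finally show "(\<lambda>N. sum f (B N)) \<in> mhs_span (mixed_words (p + q))" .
qed

section \<open>Degenerate exponent patterns and assembly of the two statements\<close>

lemma rat_span_mono: "A \<subseteq> B \<Longrightarrow> rat_span A \<subseteq> rat_span B"
proof -
  interpret Q: vector_space "\<lambda>(q::rat) (x::real). of_rat q * x"
    by (rule vector_space_rat_real)
  show "A \<subseteq> B \<Longrightarrow> rat_span A \<subseteq> rat_span B"
    unfolding rat_span_def by (rule Q.span_mono)
qed

lemma zeta3_reducible:
  assumes "reducible s1 s2 s3 s4 s5 s6 s7" "zeta3_converges s1 s2 s3 s4 s5 s6 s7"
  shows "zeta3 s1 s2 s3 s4 s5 s6 s7 \<in> rat_span (MZVs (s1 + s2 + s3 + s4 + s5 + s6 + s7) 3)"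
  using mhs_span_words_limit[of _ "{(s1 + s2 + s3 + s4 + s5 + s6 + s7, 3)}", OF _ _ zeta3_trunc_tendsto[OF assms(2)]]
    assms(1) by (auto simp: reducible_def)

text \<open>For convergent series, the exact complement of the patterns covered by
  \<open>reducible_two_directions\<close> and \<open>reducible_s7_0\<close>.\<close>

definition degenerate ::
  "nat \<Rightarrow> nat \<Rightarrow> nat \<Rightarrow> nat \<Rightarrow> nat \<Rightarrow> nat \<Rightarrow> nat \<Rightarrow> bool" where
  "degenerate s1 s2 s3 s4 s5 s6 s7 \<longleftrightarrow> \<not> two_directions s1 s2 s3 s4 s5 s6 \<or>
     s1 + s2 + s3 = 0 \<and> s7 = 0 \<and> (s4 = 0 \<or> s5 = 0 \<or> s6 = 0)"

lemma zeta3_nondegenerate: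
  assumes "zeta3_converges s1 s2 s3 s4 s5 s6 s7" "\<not> degenerate s1 s2 s3 s4 s5 s6 s7"
  shows "zeta3 s1 s2 s3 s4 s5 s6 s7 \<in> rat_span (MZVs (s1 + s2 + s3 + s4 + s5 + s6 + s7) 3)"
proof (rule zeta3_reducible[OF _ assms(1)])
  show "reducible s1 s2 s3 s4 s5 s6 s7"
  proof (cases "s7 = 0")
    case True
    then show ?thesis
      using assms zeta3_converges_m1[OF assms(1)] zeta3_converges_m2[OF assms(1)]
        zeta3_converges_m3[OF assms(1)] reducible_s7_0[of s1 s2 s3 s4 s5 s6]
      by (auto simp: degenerate_def)
  next
    case False
    then show ?thesis
      using assms reducible_two_directions[of s7 s1 s2 s3 s4 s5 s6] by (auto simp: degenerate_def)
  qed
qed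

lemma zeta3_m1_x23_s7_mixed:
  assumes "zeta3_converges a 0 0 0 p 0 e"
  shows "zeta3 a 0 0 0 p 0 e
    \<in> rat_span (MZVs (a + p + e) 3 \<union> MZVs (a + p + e - 1) 2 \<union> MZVs (a + p + e - 2) 1)"
  using zeta3_converges_m1[OF assms] zeta3_converges_m2_m3[OF assms]
  by (intro mixed_limit[OF zeta3_trunc_m1_x23_s7_mixed zeta3_trunc_tendsto[OF assms]]) auto

lemma zeta3_mixed:
  fixes s1 s2 s3 s4 s5 s6 s7 :: nat
  defines "w \<equiv> s1 + s2 + s3 + s4 + s5 + s6 + s7"
  assumes conv: "zeta3_converges s1 s2 s3 s4 s5 s6 s7"
  shows "zeta3 s1 s2 s3 s4 s5 s6 s7 \<in> rat_span (MZVs w 3 \<union> MZVs (w - 1) 2 \<union> MZVs (w - 2) 1)"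
proof (cases "degenerate s1 s2 s3 s4 s5 s6 s7")
  case False
  then have "zeta3 s1 s2 s3 s4 s5 s6 s7 \<in> rat_span (MZVs w 3)"
    unfolding w_def by (rule zeta3_nondegenerate[OF conv])
  then show ?thesis
    by (rule subsetD[OF rat_span_mono, rotated]) blast
next
  case True
  note z12 = zeta3_swap12 and z23 = zeta3_swap23
  note c12 = zeta3_converges_swap12 and c23 = zeta3_converges_swap23
  \<comment> \<open>Up to a permutation of the variables there are two shapes: a single direction
    together with \<open>m1 + m2 + m3\<close>, or at most two pair sums alone.\<close>
  from True consider "s2 = 0 \<and> s3 = 0 \<and> s4 = 0 \<and> s6 = 0" | "s1 = 0 \<and> s3 = 0 \<and> s4 = 0 \<and> s5 = 0"
    | "s1 = 0 \<and> s2 = 0 \<and> s5 = 0 \<and> s6 = 0"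
    | "s1 = 0 \<and> s2 = 0 \<and> s3 = 0 \<and> s7 = 0 \<and> s6 = 0" | "s1 = 0 \<and> s2 = 0 \<and> s3 = 0 \<and> s7 = 0 \<and> s5 = 0"
    | "s1 = 0 \<and> s2 = 0 \<and> s3 = 0 \<and> s7 = 0 \<and> s4 = 0"
    unfolding degenerate_def two_directions_def
    by (cases "s1 = 0"; cases "s2 = 0"; cases "s3 = 0"; cases "s4 = 0"; cases "s5 = 0"; cases "s6 = 0") simp_all
  then show ?thesis
  proof cases
    case 1
    with conv show ?thesis
      using zeta3_m1_x23_s7_mixed[of s1 s5 s7] by (simp add: w_def)
  next
    case 2
    with conv show ?thesis
      using zeta3_m1_x23_s7_mixed[of s2 s6 s7] z12[of 0 s2 0 0 0 s6 s7] c12[of 0 s2 0 0 0 s6 s7]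
      by (simp add: w_def)
  next
    case 3
    with conv show ?thesis
      using zeta3_m1_x23_s7_mixed[of s3 s4 s7] z12[of 0 s3 0 0 0 s4 s7] c12[of 0 s3 0 0 0 s4 s7]
        z23[of 0 0 s3 s4 0 0 s7] c23[of 0 0 s3 s4 0 0 s7]
      by (simp add: w_def)
  next
    case 4
    with conv show ?thesis
      using zeta3_x12_x23_mixed[of s4 s5] by (simp add: w_def)
  next
    case 5
    with conv show ?thesis
      using zeta3_x12_x23_mixed[of s4 s6] z12[of 0 0 0 s4 0 s6 0] c12[of 0 0 0 s4 0 s6 0]
      by (simp add: w_def)
  next
    case 6
    with conv show ?thesis
      using zeta3_x12_x23_mixed[of s6 s5] z23[of 0 0 0 0 s5 s6 0] c23[of 0 0 0 0 s5 s6 0]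
      by (simp add: w_def add.commute)
  qed
qed

lemma zeta_sl4_converges_eq_zeta3:
  "zeta_sl4_converges s1 s2 s3 s4 s5 s6 \<longleftrightarrow> zeta3_converges s1 s2 s3 s4 s5 0 s6"
  by (simp add: zeta_sl4_converges_def zeta3_converges_def zeta_sl4_term_eq_zeta3_term)

text \<open>Without \<open>m1 + m3\<close> the degenerate patterns are few. The single direction of
  \<open>m2\<close> and the two pair sums need convergence to supply the lower bounds on exponents
  that their families demand.\<close>

lemma degenerate_irregular:
  assumes conv: "zeta_sl4_converges s1 s2 s3 s4 s5 s6" and "degenerate s1 s2 s3 s4 s5 0 s6"
  shows "irregular_sl4 s1 s2 s3 s4 s5 s6"
proof -
  note c = conv[unfolded zeta_sl4_converges_eq_zeta3]
  from assms(2) consider "s2 = 0 \<and> s3 = 0 \<and> s4 = 0" | "s1 = 0 \<and> s2 \<noteq> 0 \<and> s3 = 0 \<and> s4 = 0 \<and> s5 = 0"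
    | "s1 = 0 \<and> s2 = 0 \<and> s5 = 0" | "s1 = 0 \<and> s2 = 0 \<and> s3 = 0 \<and> s6 = 0"
    unfolding degenerate_def two_directions_def
    by (cases "s1 = 0"; cases "s2 = 0"; cases "s3 = 0"; cases "s4 = 0"; cases "s5 = 0") simp_all
  then show ?thesis
  proof cases
    case 1
    with conv show ?thesis
      by (auto intro: irregular_sl4.intros)
  next
    case 2
    \<comment> \<open>The necessary condition for \<open>m1\<close> and \<open>m3\<close> running
      with \<open>m2\<close> fixed; here only \<open>s6\<close> survives on the right, which gives
      the bound a > 2.\<close>
    have "3 \<le> s1 + s3 + s4 + s5 + s6"
      using zeta3_converges_m2_m3[OF c[unfolded zeta3_converges_swap12[of s1 s2 s3 s4 s5 0 s6]]]
      by simp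
    with 2 show ?thesis
      by (auto intro: irregular_sl4.intros)
  next
    case 3
    with conv show ?thesis
      by (auto intro: irregular_sl4.intros)
  next
    case 4
    with zeta3_converges_m1[OF c] zeta3_converges_m3[OF c] show ?thesis
      by (auto intro: irregular_sl4.intros)
  qed
qed

text \<open>In depth one the weight determines the word. For \<open>w\<close> < 2 no admissible word
  exists and the left side is empty.\<close>

lemma MZVs_1_subset: "MZVs w 1 \<subseteq> {mzv [w]}"
proof
  fix x assume "x \<in> MZVs w 1"
  then obtain s where s: "x = mzv s" "admissible s" "sum_list s = w" "length s \<le> 1"
    by (auto simp: MZVs_def)
  then show "x \<in> {mzv [w]}"
    by (cases s) (auto simp: admissible_def)
qed

theorem theorem1p1:
  "(\<forall>s1 s2 s3 s4 s5 s6 s7 :: nat. zeta3_converges s1 s2 s3 s4 s5 s6 s7 \<longrightarrow>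
      (s1 \<ge> 1 \<and> s2 \<ge> 1 \<and> s3 \<ge> 1 \<and> s4 \<ge> 1 \<and> s5 \<ge> 1 \<and> s6 \<ge> 1 \<and> s7 \<ge> 1 \<longrightarrow>
         zeta3 s1 s2 s3 s4 s5 s6 s7 \<in> rat_span (MZVs (s1 + s2 + s3 + s4 + s5 + s6 + s7) 3)) \<and>
      zeta3 s1 s2 s3 s4 s5 s6 s7
        \<in> rat_span (\<Union>k\<le>s1 + s2 + s3 + s4 + s5 + s6 + s7. MZVs k 3)) \<and>
   (\<forall>w s1 s2 s3 s4 s5 s6 :: nat.
      w > 0 \<and> s1 + s2 + s3 + s4 + s5 + s6 = w \<and> zeta_sl4_converges s1 s2 s3 s4 s5 s6 \<longrightarrow>
      (\<not> irregular_sl4 s1 s2 s3 s4 s5 s6 \<longrightarrow>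
         zeta_sl4 s1 s2 s3 s4 s5 s6 \<in> rat_span (MZVs w 3)) \<and>
      (irregular_sl4 s1 s2 s3 s4 s5 s6 \<longrightarrow>
         zeta_sl4 s1 s2 s3 s4 s5 s6
           \<in> rat_span (MZVs w 3 \<union> MZVs (w - 1) 2 \<union> {mzv [w - 2]})))"
proof (intro conjI allI impI)
  fix s1 s2 s3 s4 s5 s6 s7 :: nat
  let ?w = "s1 + s2 + s3 + s4 + s5 + s6 + s7"
  assume conv: "zeta3_converges s1 s2 s3 s4 s5 s6 s7"
  show "zeta3 s1 s2 s3 s4 s5 s6 s7 \<in> rat_span (MZVs ?w 3)"
    if "s1 \<ge> 1 \<and> s2 \<ge> 1 \<and> s3 \<ge> 1 \<and> s4 \<ge> 1 \<and> s5 \<ge> 1 \<and> s6 \<ge> 1 \<and> s7 \<ge> 1"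
    using that by (intro zeta3_nondegenerate conv) (auto simp: degenerate_def two_directions_def)
  have "MZVs (?w - 1) 2 \<subseteq> MZVs (?w - 1) 3" "MZVs (?w - 2) 1 \<subseteq> MZVs (?w - 2) 3"
    by (fastforce simp: MZVs_def)+
  then have "MZVs ?w 3 \<union> MZVs (?w - 1) 2 \<union> MZVs (?w - 2) 1 \<subseteq> (\<Union>k\<le>?w. MZVs k 3)"
    by (intro Un_least) (force intro: UN_I[of ?w] UN_I[of "?w - 1"] UN_I[of "?w - 2"])+
  from rat_span_mono[OF this] show "zeta3 s1 s2 s3 s4 s5 s6 s7 \<in> rat_span (\<Union>k\<le>?w. MZVs k 3)"
    using zeta3_mixed[OF conv] by blast
next
  fix w s1 s2 s3 s4 s5 s6 :: nat
  assume A: "w > 0 \<and> s1 + s2 + s3 + s4 + s5 + s6 = w \<and> zeta_sl4_converges s1 s2 s3 s4 s5 s6"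
  then have conv: "zeta3_converges s1 s2 s3 s4 s5 0 s6" and w: "w = s1 + s2 + s3 + s4 + s5 + 0 + s6"
    by (auto simp: zeta_sl4_converges_eq_zeta3)
  show "zeta_sl4 s1 s2 s3 s4 s5 s6 \<in> rat_span (MZVs w 3)" if "\<not> irregular_sl4 s1 s2 s3 s4 s5 s6"
    unfolding w zeta_sl4_eq_zeta3
    using A that degenerate_irregular by (intro zeta3_nondegenerate conv) blast
  have "MZVs w 3 \<union> MZVs (w - 1) 2 \<union> MZVs (w - 2) 1 \<subseteq> MZVs w 3 \<union> MZVs (w - 1) 2 \<union> {mzv [w - 2]}"
    using MZVs_1_subset by blast
  from rat_span_mono[OF this] show "zeta_sl4 s1 s2 s3 s4 s5 s6 \<in> rat_span (MZVs w 3 \<union> MZVs (w - 1) 2 \<union> {mzv [w - 2]})"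
    using zeta3_mixed[OF conv] unfolding w zeta_sl4_eq_zeta3 by blast
qed

end
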